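(* Let $(L,\alpha)$ be an $A/k$-Lie-Rinehart algebra and let $f\in Z^2(\operatorname{Der}_k(A),A)$ be a 2-cocycle. The assignment $C_f$ (given on objects by $C_f(E,\nabla):=(E,\rho_\nabla)$ with $\rho_\nabla(az+x):=a\psi+\nabla(x)$, and on morphisms by $C_f(\phi):=\phi$) is an equivalence of categories $$C_f:\operatorname{Conn}(L,\operatorname{End})\to\operatorname{Conn}(L(f^{\alpha}))$$ from the category of $(L,\psi)$-connections $\nabla$ to the category of $L(f^{\alpha})$-connections $\rho$. Let $u:=az+x$, $v:=bz+y\in L(f^{\alpha})$ and let $e\in E$, where $(E,\nabla)$ is an $L$-connection, and let $\rho_\nabla:=C_f(\nabla)$. Then $$R_{\rho_\nabla}(u,v)(e)=R_\nabla(x,y)(e)-f^{\alpha}(x,y)\,e.$$ For any $L(f^{\alpha})$-connection $(E,\rho)$ there is an $(L,\psi)$-connection $(E,\nabla)$ (for some $\psi\in\operatorname{End}_A(E)$) with $C_f(E,\nabla)=(E,\rho)$.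
   Context: $k$ is a commutative unital ring and $A$ a commutative unital $k$-algebra. $I$ is the kernel of the multiplication $A\otimes_k A\to A$ and $P:=A\otimes_k A/I^2$. A left $P$-module is a left $A\otimes_k A$-module annihilated by $I^2$; write $cu:=(c\otimes 1)u$, $uc:=(1\otimes c)u$. An $A/k$-Lie-Rinehart algebra $(L,\alpha)$ is a $k$-Lie algebra and left $A$-module $L$ with an $A$-linear map of $k$-Lie algebras $\alpha:L\to\operatorname{Der}_k(A)$ such that $[x,ay]=a[x,y]+\alpha(x)(a)y$. $Z^2(L,A)$ is the group of 2-cocycles of the Lie-Rinehart complex $C^p(L,A)=\operatorname{Hom}_A(\wedge^p_A L,A)$; $\operatorname{Der}_k(A)$ is a Lie-Rinehart algebra with identity anchor. For $f\in Z^2(\operatorname{Der}_k(A),A)$ let $f^{\alpha}(x,y):=f(\alpha(x),\alpha(y))\in Z^2(L,A)$. $L(f^{\alpha}):=Az\oplus L$ (with $Az$ free of rank one on $z$) is the $k$-Lie algebra and left $P$-module with $[az+x,bz+y]:=(\alpha(x)(b)-\alpha(y)(a)+f^{\alpha}(x,y))z+[x,y]$, $c(az+x):=caz+cx$, $(az+x)c:=(ac+\alpha(x)(c))z+cx$. For a left $A$-module $E$, $\operatorname{Diff}^1(E)$ is the set of $\partial\in\operatorname{End}_k(E)$ with $[[\partial,a],b]=0$ for all $a,b\in A$ (acting by multiplication); it is a left $P$-module by $(a\otimes b\cdot\partial)(e):=a\partial(be)$. An $L(f^{\alpha})$-connection is a pair $(E,\rho)$ with $\rho:L(f^{\alpha})\to\operatorname{Diff}^1(E)$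 a map of left $P$-modules; its curvature is $R_\rho(u,v):=[\rho(u),\rho(v)]-\rho([u,v])$. A map $(E,\rho_E)\to(F,\rho_F)$ is an $A$-linear $\phi:E\to F$ with $\rho_F(u)\circ\phi=\phi\circ\rho_E(u)$ for all $u$. These form the category $\operatorname{Conn}(L(f^{\alpha}))$. For $\psi\in\operatorname{End}_A(E)$, an $(L,\psi)$-connection on $E$ is an $A$-linear map $\nabla:L\to\operatorname{End}_k(E)$ with $\nabla(x)(ae)=a\nabla(x)(e)+\alpha(x)(a)\psi(e)$. An ($L$-)connection is the case $\psi=\operatorname{Id}_E$; its curvature is $R_\nabla(x,y):=[\nabla(x),\nabla(y)]-\nabla([x,y])$. $\operatorname{Conn}(L,\operatorname{End})$ is the category of $(L,\psi)$-connections $(E,\nabla)$, where $E$ and $\psi\in\operatorname{End}_A(E)$ may vary ($\psi$ being part of the data); morphisms are $A$-linear maps $\phi:E\to F$ compatible with the data: $\phi\circ\nabla(x)=\nabla'(x)\circ\phi$ for all $x\in L$ and $\phi\circ\psi=\psi'\circ\phi$. *)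

theory Defs
  imports "HOL-Algebra.Module" "HOL-Algebra.QuotRing" "HOL-Algebra.Ideal_Product" "HOL-Library.Poly_Mapping"
begin

section \<open>Categories\<close>

text \<open>Hom-sets belonging to different pairs of objects may overlap, so composition and
  functors take the objects as explicit arguments: \<open>cat_comp C X Y Z g f\<close> is the composite
  of \<open>f\<close> from \<open>X\<close> to \<open>Y\<close> and \<open>g\<close> from \<open>Y\<close> to \<open>Z\<close>.\<close>

record ('o, 'm) precat =
  obj :: "'o set"
  hom_set :: "'o \<Rightarrow> 'o \<Rightarrow> 'm set"
  cat_id :: "'o \<Rightarrow> 'm"
  cat_comp :: "'o \<Rightarrow> 'o \<Rightarrow> 'o \<Rightarrow> 'm \<Rightarrow> 'm \<Rightarrow> 'm"

locale category =
  fixes C :: "('o, 'm) precat"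
  assumes ident_closed: "X \<in> obj C \<Longrightarrow> cat_id C X \<in> hom_set C X X"
    and comp_closed: "\<lbrakk>X \<in> obj C; Y \<in> obj C; Z \<in> obj C; f \<in> hom_set C X Y; g \<in> hom_set C Y Z\<rbrakk>
      \<Longrightarrow> cat_comp C X Y Z g f \<in> hom_set C X Z"
    and comp_ident_right: "\<lbrakk>X \<in> obj C; Y \<in> obj C; f \<in> hom_set C X Y\<rbrakk>
      \<Longrightarrow> cat_comp C X X Y f (cat_id C X) = f"
    and comp_ident_left: "\<lbrakk>X \<in> obj C; Y \<in> obj C; f \<in> hom_set C X Y\<rbrakk>
      \<Longrightarrow> cat_comp C X Y Y (cat_id C Y) f = f"
    and comp_assoc: "\<lbrakk>W \<in> obj C; X \<in> obj C; Y \<in> obj C; Z \<in> obj C;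
        f \<in> hom_set C W X; g \<in> hom_set C X Y; h \<in> hom_set C Y Z\<rbrakk>
      \<Longrightarrow> cat_comp C W Y Z h (cat_comp C W X Y g f) = cat_comp C W X Z (cat_comp C X Y Z h g) f"

locale cat_functor =
  fixes C :: "('o, 'm) precat" and D :: "('p, 'n) precat"
    and Fo :: "'o \<Rightarrow> 'p" and Fm :: "'o \<Rightarrow> 'o \<Rightarrow> 'm \<Rightarrow> 'n"
  assumes obj_closed: "X \<in> obj C \<Longrightarrow> Fo X \<in> obj D"
    and hom_closed: "\<lbrakk>X \<in> obj C; Y \<in> obj C; f \<in> hom_set C X Y\<rbrakk>
      \<Longrightarrow> Fm X Y f \<in> hom_set D (Fo X) (Fo Y)"
    and pres_ident: "X \<in> obj C \<Longrightarrow> Fm X X (cat_id C X) = cat_id D (Fo X)"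
    and pres_comp: "\<lbrakk>X \<in> obj C; Y \<in> obj C; Z \<in> obj C; f \<in> hom_set C X Y; g \<in> hom_set C Y Z\<rbrakk>
      \<Longrightarrow> Fm X Z (cat_comp C X Y Z g f) = cat_comp D (Fo X) (Fo Y) (Fo Z) (Fm Y Z g) (Fm X Y f)"

definition is_iso_in :: "('o, 'm) precat \<Rightarrow> 'o \<Rightarrow> 'o \<Rightarrow> 'm \<Rightarrow> bool" where
  "is_iso_in C X Y f \<longleftrightarrow> f \<in> hom_set C X Y \<and>
     (\<exists>g \<in> hom_set C Y X. cat_comp C X Y X g f = cat_id C X \<and> cat_comp C Y X Y f g = cat_id C Y)"

locale natural_iso =
  fixes C :: "('o, 'm) precat" and D :: "('p, 'n) precat"
    and Fo :: "'o \<Rightarrow> 'p" and Fm :: "'o \<Rightarrow> 'o \<Rightarrow> 'm \<Rightarrow> 'n"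
    and Go :: "'o \<Rightarrow> 'p" and Gm :: "'o \<Rightarrow> 'o \<Rightarrow> 'm \<Rightarrow> 'n"
    and \<eta> :: "'o \<Rightarrow> 'n"
  assumes iso: "X \<in> obj C \<Longrightarrow> is_iso_in D (Fo X) (Go X) (\<eta> X)"
    and natural: "\<lbrakk>X \<in> obj C; Y \<in> obj C; f \<in> hom_set C X Y\<rbrakk>
      \<Longrightarrow> cat_comp D (Fo X) (Fo Y) (Go Y) (\<eta> Y) (Fm X Y f)
        = cat_comp D (Fo X) (Go X) (Go Y) (Gm X Y f) (\<eta> X)"

definition equivalence_of_categories ::
  "('o, 'm) precat \<Rightarrow> ('p, 'n) precat \<Rightarrow> ('o \<Rightarrow> 'p) \<Rightarrow> ('o \<Rightarrow> 'o \<Rightarrow> 'm \<Rightarrow> 'n) \<Rightarrow> bool" where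
  "equivalence_of_categories C D Fo Fm \<longleftrightarrow>
     category C \<and> category D \<and> cat_functor C D Fo Fm \<and>
     (\<exists>Go Gm. cat_functor D C Go Gm \<and>
        (\<exists>\<eta>. natural_iso C C (\<lambda>X. X) (\<lambda>X Y f. f)
               (\<lambda>X. Go (Fo X)) (\<lambda>X Y f. Gm (Fo X) (Fo Y) (Fm X Y f)) \<eta>) \<and>
        (\<exists>\<epsilon>. natural_iso D D (\<lambda>X. Fo (Go X)) (\<lambda>X Y f. Fm (Go X) (Go Y) (Gm X Y f))
               (\<lambda>X. X) (\<lambda>X Y f. f) \<epsilon>))"


section \<open>Linear maps, endomorphisms and commutators\<close>

definition lin_maps ::
  "('a, 'q) ring_scheme \<Rightarrow> ('a, 'm, 'r) module_scheme \<Rightarrow> ('a, 'n, 's) module_scheme \<Rightarrow> ('m \<Rightarrow> 'n) set"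
where
  "lin_maps R M N = {h \<in> carrier M \<rightarrow> carrier N.
     (\<forall>x\<in>carrier M. \<forall>y\<in>carrier M. h (x \<oplus>\<^bsub>M\<^esub> y) = h x \<oplus>\<^bsub>N\<^esub> h y) \<and>
     (\<forall>a\<in>carrier R. \<forall>x\<in>carrier M. h (a \<odot>\<^bsub>M\<^esub> x) = a \<odot>\<^bsub>N\<^esub> h x)}"

text \<open>Set-theoretic maps whose equality matters (operators, connections, morphisms) are
  taken to be extensional on the carrier of their domain.\<close>

definition op_add :: "('e, 'r) ring_scheme \<Rightarrow> ('e \<Rightarrow> 'e) \<Rightarrow> ('e \<Rightarrow> 'e) \<Rightarrow> 'e \<Rightarrow> 'e" where
  "op_add M s t = (\<lambda>e\<in>carrier M. s e \<oplus>\<^bsub>M\<^esub> t e)"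

definition op_zero :: "('e, 'r) ring_scheme \<Rightarrow> 'e \<Rightarrow> 'e" where
  "op_zero M = (\<lambda>e\<in>carrier M. \<zero>\<^bsub>M\<^esub>)"

definition commutator :: "('e, 'r) ring_scheme \<Rightarrow> ('e \<Rightarrow> 'e) \<Rightarrow> ('e \<Rightarrow> 'e) \<Rightarrow> 'e \<Rightarrow> 'e" where
  "commutator M s t = (\<lambda>e\<in>carrier M. s (t e) \<ominus>\<^bsub>M\<^esub> t (s e))"

definition mult_op :: "('a, 'e, 'r) module_scheme \<Rightarrow> 'a \<Rightarrow> 'e \<Rightarrow> 'e" where
  "mult_op E a = (\<lambda>e\<in>carrier E. a \<odot>\<^bsub>E\<^esub> e)"

text \<open>The base ring \<open>k\<close> acts on an \<open>A\<close>-module through the structure map of \<open>A\<close>.\<close>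

definition struct_map :: "('k, 'a, 'q) module_scheme \<Rightarrow> 'k \<Rightarrow> 'a" where
  "struct_map A c = c \<odot>\<^bsub>A\<^esub> \<one>\<^bsub>A\<^esub>"

text \<open>The ring operations \<open>mult\<close> and \<open>one\<close> that a module record carries along play no role
  in the theory of modules; they are left unspecified throughout.\<close>

definition End_k ::
  "('k, 'z) ring_scheme \<Rightarrow> ('k, 'a, 'q) module_scheme \<Rightarrow> ('a, 'e, 'r) module_scheme \<Rightarrow> ('a, 'e \<Rightarrow> 'e) module"
where
  "End_k k A E = \<lparr>
     carrier = {s \<in> carrier E \<rightarrow>\<^sub>E carrier E.
       (\<forall>e\<in>carrier E. \<forall>e'\<in>carrier E. s (e \<oplus>\<^bsub>E\<^esub> e') = s e \<oplus>\<^bsub>E\<^esub> s e') \<and>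
       (\<forall>c\<in>carrier k. \<forall>e\<in>carrier E.
          s (struct_map A c \<odot>\<^bsub>E\<^esub> e) = struct_map A c \<odot>\<^bsub>E\<^esub> s e)},
     monoid.mult = undefined, one = undefined,
     zero = op_zero E, add = op_add E,
     smult = (\<lambda>a s. \<lambda>e\<in>carrier E. a \<odot>\<^bsub>E\<^esub> s e)\<rparr>"

definition End_A :: "('k, 'a, 'q) module_scheme \<Rightarrow> ('a, 'e, 'r) module_scheme \<Rightarrow> ('e \<Rightarrow> 'e) set" where
  "End_A A E = lin_maps A E E \<inter> extensional (carrier E)"


section \<open>Lie algebras and Lie-Rinehart algebras\<close>

record ('a, 'l) lie_module = "('a, 'l) module" +
  lbr :: "'l \<Rightarrow> 'l \<Rightarrow> 'l"

locale lie_algebra = module k L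
  for k :: "('k, 'z) ring_scheme" and L :: "('k, 'l, 'r) lie_module_scheme" +
  assumes lbr_closed: "\<lbrakk>x \<in> carrier L; y \<in> carrier L\<rbrakk> \<Longrightarrow> lbr L x y \<in> carrier L"
    and lbr_add_left: "\<lbrakk>x \<in> carrier L; y \<in> carrier L; z \<in> carrier L\<rbrakk>
      \<Longrightarrow> lbr L (x \<oplus>\<^bsub>L\<^esub> y) z = lbr L x z \<oplus>\<^bsub>L\<^esub> lbr L y z"
    and lbr_add_right: "\<lbrakk>x \<in> carrier L; y \<in> carrier L; z \<in> carrier L\<rbrakk>
      \<Longrightarrow> lbr L x (y \<oplus>\<^bsub>L\<^esub> z) = lbr L x y \<oplus>\<^bsub>L\<^esub> lbr L x z"
    and lbr_smult_left: "\<lbrakk>c \<in> carrier k; x \<in> carrier L; y \<in> carrier L\<rbrakk>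
      \<Longrightarrow> lbr L (c \<odot>\<^bsub>L\<^esub> x) y = c \<odot>\<^bsub>L\<^esub> lbr L x y"
    and lbr_smult_right: "\<lbrakk>c \<in> carrier k; x \<in> carrier L; y \<in> carrier L\<rbrakk>
      \<Longrightarrow> lbr L x (c \<odot>\<^bsub>L\<^esub> y) = c \<odot>\<^bsub>L\<^esub> lbr L x y"
    and lbr_alternating: "x \<in> carrier L \<Longrightarrow> lbr L x x = \<zero>\<^bsub>L\<^esub>"
    and lbr_jacobi: "\<lbrakk>x \<in> carrier L; y \<in> carrier L; z \<in> carrier L\<rbrakk>
      \<Longrightarrow> lbr L x (lbr L y z) \<oplus>\<^bsub>L\<^esub> lbr L y (lbr L z x) \<oplus>\<^bsub>L\<^esub> lbr L z (lbr L x y) = \<zero>\<^bsub>L\<^esub>"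

definition restrict_scalars ::
  "('k, 'a, 'q) module_scheme \<Rightarrow> ('a, 'l) lie_module \<Rightarrow> ('k, 'l) lie_module" where
  "restrict_scalars A L = \<lparr>
     carrier = carrier L, monoid.mult = monoid.mult L, one = one L, zero = zero L, add = add L,
     smult = (\<lambda>c x. struct_map A c \<odot>\<^bsub>L\<^esub> x), lbr = lbr L\<rparr>"

definition Der ::
  "('k, 'z) ring_scheme \<Rightarrow> ('k, 'a, 'q) module_scheme \<Rightarrow> ('a, 'a \<Rightarrow> 'a) lie_module" where
  "Der k A = \<lparr>
     carrier = {D \<in> carrier A \<rightarrow>\<^sub>E carrier A.
       (\<forall>a\<in>carrier A. \<forall>b\<in>carrier A. D (a \<oplus>\<^bsub>A\<^esub> b) = D a \<oplus>\<^bsub>A\<^esub> D b) \<and>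
       (\<forall>c\<in>carrier k. \<forall>a\<in>carrier A. D (c \<odot>\<^bsub>A\<^esub> a) = c \<odot>\<^bsub>A\<^esub> D a) \<and>
       (\<forall>a\<in>carrier A. \<forall>b\<in>carrier A. D (a \<otimes>\<^bsub>A\<^esub> b) = a \<otimes>\<^bsub>A\<^esub> D b \<oplus>\<^bsub>A\<^esub> D a \<otimes>\<^bsub>A\<^esub> b)},
     monoid.mult = undefined, one = undefined,
     zero = op_zero A, add = op_add A,
     smult = (\<lambda>a D. \<lambda>b\<in>carrier A. a \<otimes>\<^bsub>A\<^esub> D b),
     lbr = commutator A\<rparr>"

definition lie_rinehart ::
  "('k, 'z) ring_scheme \<Rightarrow> ('k, 'a, 'q) module_scheme \<Rightarrow> ('a, 'l) lie_module \<Rightarrow> ('l \<Rightarrow> 'a \<Rightarrow> 'a) \<Rightarrow> bool"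
where
  "lie_rinehart k A L \<alpha> \<longleftrightarrow>
     algebra k A \<and> module A L \<and> lie_algebra k (restrict_scalars A L) \<and>
     \<alpha> \<in> lin_maps A L (Der k A) \<and>
     (\<forall>x\<in>carrier L. \<forall>y\<in>carrier L. \<alpha> (lbr L x y) = lbr (Der k A) (\<alpha> x) (\<alpha> y)) \<and>
     (\<forall>x\<in>carrier L. \<forall>y\<in>carrier L. \<forall>a\<in>carrier A.
        lbr L x (a \<odot>\<^bsub>L\<^esub> y) = a \<odot>\<^bsub>L\<^esub> lbr L x y \<oplus>\<^bsub>L\<^esub> \<alpha> x a \<odot>\<^bsub>L\<^esub> y)"

text \<open>Elements of \<open>Hom\<^sub>A(\<Lambda>\<^sup>2L, A)\<close>, as alternating \<open>A\<close>-bilinear maps.\<close>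

definition lr_cochains2 ::
  "('k, 'a, 'q) module_scheme \<Rightarrow> ('a, 'l) lie_module \<Rightarrow> ('l \<Rightarrow> 'l \<Rightarrow> 'a) set" where
  "lr_cochains2 A L = {f \<in> carrier L \<rightarrow> carrier L \<rightarrow> carrier A.
     (\<forall>x\<in>carrier L. \<forall>y\<in>carrier L. \<forall>z\<in>carrier L.
        f (x \<oplus>\<^bsub>L\<^esub> y) z = f x z \<oplus>\<^bsub>A\<^esub> f y z \<and> f x (y \<oplus>\<^bsub>L\<^esub> z) = f x y \<oplus>\<^bsub>A\<^esub> f x z) \<and>
     (\<forall>a\<in>carrier A. \<forall>x\<in>carrier L. \<forall>y\<in>carrier L.
        f (a \<odot>\<^bsub>L\<^esub> x) y = a \<otimes>\<^bsub>A\<^esub> f x y \<and> f x (a \<odot>\<^bsub>L\<^esub> y) = a \<otimes>\<^bsub>A\<^esub> f x y) \<and>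
     (\<forall>x\<in>carrier L. f x x = \<zero>\<^bsub>A\<^esub>)}"

text \<open>The differential of the Lie-Rinehart complex from degree 2 to degree 3: the sum of
  \<open>(-1)^(i+1) \<alpha>(x_i)(f(...))\<close> over \<open>i\<close>, with \<open>x_i\<close> omitted from the arguments of \<open>f\<close>, and of
  \<open>(-1)^(i+j) f([x_i,x_j],...)\<close> over \<open>i < j\<close>, with \<open>x_i\<close> and \<open>x_j\<close> omitted.\<close>

definition lr_diff2 ::
  "('k, 'a, 'q) module_scheme \<Rightarrow> ('a, 'l) lie_module \<Rightarrow> ('l \<Rightarrow> 'a \<Rightarrow> 'a) \<Rightarrow>
   ('l \<Rightarrow> 'l \<Rightarrow> 'a) \<Rightarrow> 'l \<Rightarrow> 'l \<Rightarrow> 'l \<Rightarrow> 'a" where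
  "lr_diff2 A L \<alpha> f x y z =
     \<alpha> x (f y z) \<ominus>\<^bsub>A\<^esub> \<alpha> y (f x z) \<oplus>\<^bsub>A\<^esub> \<alpha> z (f x y)
     \<ominus>\<^bsub>A\<^esub> f (lbr L x y) z \<oplus>\<^bsub>A\<^esub> f (lbr L x z) y \<ominus>\<^bsub>A\<^esub> f (lbr L y z) x"

definition lr_Z2 ::
  "('k, 'a, 'q) module_scheme \<Rightarrow> ('a, 'l) lie_module \<Rightarrow> ('l \<Rightarrow> 'a \<Rightarrow> 'a) \<Rightarrow> ('l \<Rightarrow> 'l \<Rightarrow> 'a) set"
where
  "lr_Z2 A L \<alpha> = {f \<in> lr_cochains2 A L.
     \<forall>x\<in>carrier L. \<forall>y\<in>carrier L. \<forall>z\<in>carrier L. lr_diff2 A L \<alpha> f x y z = \<zero>\<^bsub>A\<^esub>}"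

definition pullback2 ::
  "('l \<Rightarrow> 'd) \<Rightarrow> ('d \<Rightarrow> 'd \<Rightarrow> 'a) \<Rightarrow> 'l \<Rightarrow> 'l \<Rightarrow> 'a" where
  "pullback2 \<alpha> f x y = f (\<alpha> x) (\<alpha> y)"


section \<open>The tensor square of \<open>A\<close> over \<open>k\<close>, and first order principal parts\<close>

text \<open>The free abelian group on \<open>A \<times> A\<close>, with the multiplication for which the generators
  multiply componentwise.\<close>

definition pair_ring :: "('k, 'a, 'q) module_scheme \<Rightarrow> (('a \<times> 'a) \<Rightarrow>\<^sub>0 int) ring" where
  "pair_ring A = \<lparr>
     carrier = {w. Poly_Mapping.keys w \<subseteq> carrier A \<times> carrier A},
     monoid.mult = (\<lambda>w w'. frag_extend (\<lambda>(a, b).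
        frag_extend (\<lambda>(a', b'). frag_of (a \<otimes>\<^bsub>A\<^esub> a', b \<otimes>\<^bsub>A\<^esub> b')) w') w),
     one = frag_of (\<one>\<^bsub>A\<^esub>, \<one>\<^bsub>A\<^esub>),
     zero = 0, add = (+)\<rparr>"

definition tensor_rels ::
  "('k, 'z) ring_scheme \<Rightarrow> ('k, 'a, 'q) module_scheme \<Rightarrow> (('a \<times> 'a) \<Rightarrow>\<^sub>0 int) set" where
  "tensor_rels k A =
     {frag_of (a \<oplus>\<^bsub>A\<^esub> a', b) - frag_of (a, b) - frag_of (a', b) | a a' b.
        a \<in> carrier A \<and> a' \<in> carrier A \<and> b \<in> carrier A} \<union>
     {frag_of (a, b \<oplus>\<^bsub>A\<^esub> b') - frag_of (a, b) - frag_of (a, b') | a b b'.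
        a \<in> carrier A \<and> b \<in> carrier A \<and> b' \<in> carrier A} \<union>
     {frag_of (c \<odot>\<^bsub>A\<^esub> a, b) - frag_of (a, c \<odot>\<^bsub>A\<^esub> b) | c a b.
        c \<in> carrier k \<and> a \<in> carrier A \<and> b \<in> carrier A}"

definition tensor_sq ::
  "('k, 'z) ring_scheme \<Rightarrow> ('k, 'a, 'q) module_scheme \<Rightarrow> (('a \<times> 'a) \<Rightarrow>\<^sub>0 int) set ring" where
  "tensor_sq k A = pair_ring A Quot genideal (pair_ring A) (tensor_rels k A)"

text \<open>The additive extension to formal sums of pairs of a map \<open>h\<close> on pairs.\<close>

definition frag_lift :: "('m, 'r) ring_scheme \<Rightarrow> ('b \<Rightarrow> 'm) \<Rightarrow> ('b \<Rightarrow>\<^sub>0 int) \<Rightarrow> 'm" where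
  "frag_lift M h w = finsum M (\<lambda>p. add_pow M (Poly_Mapping.lookup w p) (h p)) (Poly_Mapping.keys w)"

definition mult_map :: "('k, 'a, 'q) module_scheme \<Rightarrow> (('a \<times> 'a) \<Rightarrow>\<^sub>0 int) set \<Rightarrow> 'a" where
  "mult_map A t = the_elem (frag_lift A (\<lambda>(a, b). a \<otimes>\<^bsub>A\<^esub> b) ` t)"

definition diag_ideal ::
  "('k, 'z) ring_scheme \<Rightarrow> ('k, 'a, 'q) module_scheme \<Rightarrow> (('a \<times> 'a) \<Rightarrow>\<^sub>0 int) set set" where
  "diag_ideal k A = a_kernel (tensor_sq k A) A (mult_map A)"

definition princ_parts ::
  "('k, 'z) ring_scheme \<Rightarrow> ('k, 'a, 'q) module_scheme \<Rightarrow> (('a \<times> 'a) \<Rightarrow>\<^sub>0 int) set set ring" where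
  "princ_parts k A =
     tensor_sq k A Quot ideal_prod (tensor_sq k A) (diag_ideal k A) (diag_ideal k A)"

text \<open>The action of the class \<open>p\<close> of \<open>\<Sum> a\<^sub>i \<otimes> b\<^sub>i\<close> on an abelian group with a left action
  \<open>l a u = (a \<otimes> 1)u\<close> and a right action \<open>r u b = (1 \<otimes> b)u\<close>. The actions used below are
  compatible with the relations of \<open>princ_parts\<close>, so that the set has exactly one element.\<close>

definition parts_smult ::
  "('m, 'r) ring_scheme \<Rightarrow> ('a \<Rightarrow> 'm \<Rightarrow> 'm) \<Rightarrow> ('m \<Rightarrow> 'a \<Rightarrow> 'm) \<Rightarrow>
   (('a \<times> 'a) \<Rightarrow>\<^sub>0 int) set set \<Rightarrow> 'm \<Rightarrow> 'm" where
  "parts_smult M l r p u = the_elem ((\<lambda>w. frag_lift M (\<lambda>(a, b). l a (r u b)) w) ` \<Union>p)"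


section \<open>The extension \<open>L(f\<^sup>\<alpha>)\<close>\<close>

text \<open>The pair \<open>(a, x)\<close> stands for \<open>az + x\<close>; the cocycle \<open>g\<close> on \<open>L\<close> will be \<open>f\<^sup>\<alpha>\<close>.\<close>

definition ext_group :: "('k, 'a, 'q) module_scheme \<Rightarrow> ('a, 'l) lie_module \<Rightarrow> ('a \<times> 'l) ring" where
  "ext_group A L = \<lparr>
     carrier = carrier A \<times> carrier L,
     monoid.mult = undefined, one = undefined,
     zero = (\<zero>\<^bsub>A\<^esub>, \<zero>\<^bsub>L\<^esub>),
     add = (\<lambda>(a, x) (b, y). (a \<oplus>\<^bsub>A\<^esub> b, x \<oplus>\<^bsub>L\<^esub> y))\<rparr>"

definition ext_left ::
  "('k, 'a, 'q) module_scheme \<Rightarrow> ('a, 'l) lie_module \<Rightarrow> 'a \<Rightarrow> 'a \<times> 'l \<Rightarrow> 'a \<times> 'l" where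
  "ext_left A L c = (\<lambda>(a, x). (c \<otimes>\<^bsub>A\<^esub> a, c \<odot>\<^bsub>L\<^esub> x))"

definition ext_right ::
  "('k, 'a, 'q) module_scheme \<Rightarrow> ('a, 'l) lie_module \<Rightarrow> ('l \<Rightarrow> 'a \<Rightarrow> 'a) \<Rightarrow> 'a \<times> 'l \<Rightarrow> 'a \<Rightarrow> 'a \<times> 'l"
where
  "ext_right A L \<alpha> = (\<lambda>(a, x) c. (a \<otimes>\<^bsub>A\<^esub> c \<oplus>\<^bsub>A\<^esub> \<alpha> x c, c \<odot>\<^bsub>L\<^esub> x))"

definition lr_ext ::
  "('k, 'a, 'q) module_scheme \<Rightarrow> ('a, 'l) lie_module \<Rightarrow> ('l \<Rightarrow> 'a \<Rightarrow> 'a) \<Rightarrow> ('l \<Rightarrow> 'l \<Rightarrow> 'a) \<Rightarrow>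
   ((('a \<times> 'a) \<Rightarrow>\<^sub>0 int) set set, 'a \<times> 'l) lie_module" where
  "lr_ext A L \<alpha> g = \<lparr>
     carrier = carrier (ext_group A L),
     monoid.mult = undefined, one = undefined,
     zero = zero (ext_group A L), add = add (ext_group A L),
     smult = parts_smult (ext_group A L) (ext_left A L) (ext_right A L \<alpha>),
     lbr = (\<lambda>(a, x) (b, y). (\<alpha> x b \<ominus>\<^bsub>A\<^esub> \<alpha> y a \<oplus>\<^bsub>A\<^esub> g x y, lbr L x y))\<rparr>"


section \<open>First order differential operators and connections\<close>

definition Diff1 ::
  "('k, 'z) ring_scheme \<Rightarrow> ('k, 'a, 'q) module_scheme \<Rightarrow> ('a, 'e) module \<Rightarrow>
   ((('a \<times> 'a) \<Rightarrow>\<^sub>0 int) set set, 'e \<Rightarrow> 'e) module" where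
  "Diff1 k A E = \<lparr>
     carrier = {\<delta> \<in> carrier (End_k k A E). \<forall>a\<in>carrier A. \<forall>b\<in>carrier A.
       commutator E (commutator E \<delta> (mult_op E a)) (mult_op E b) = op_zero E},
     monoid.mult = undefined, one = undefined,
     zero = op_zero E, add = op_add E,
     smult = parts_smult (End_k k A E)
       (\<lambda>a \<delta>. \<lambda>e\<in>carrier E. a \<odot>\<^bsub>E\<^esub> \<delta> e) (\<lambda>\<delta> b. \<lambda>e\<in>carrier E. \<delta> (b \<odot>\<^bsub>E\<^esub> e))\<rparr>"

text \<open>\<open>\<rho>\<close> is a connection on \<open>E\<close> for a left module \<open>U\<close> over the principal parts:
  a map of modules over the principal parts from \<open>U\<close> to the operators of order at most one.\<close>

definition parts_connection ::
  "('k, 'z) ring_scheme \<Rightarrow> ('k, 'a, 'q) module_scheme \<Rightarrow>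
   ((('a \<times> 'a) \<Rightarrow>\<^sub>0 int) set set, 'u) lie_module \<Rightarrow> ('a, 'e) module \<Rightarrow> ('u \<Rightarrow> 'e \<Rightarrow> 'e) \<Rightarrow> bool"
where
  "parts_connection k A U E \<rho> \<longleftrightarrow>
     \<rho> \<in> lin_maps (princ_parts k A) U (Diff1 k A E) \<inter> extensional (carrier U)"

definition psi_connection ::
  "('k, 'z) ring_scheme \<Rightarrow> ('k, 'a, 'q) module_scheme \<Rightarrow> ('a, 'l) lie_module \<Rightarrow> ('l \<Rightarrow> 'a \<Rightarrow> 'a) \<Rightarrow>
   ('a, 'e) module \<Rightarrow> ('e \<Rightarrow> 'e) \<Rightarrow> ('l \<Rightarrow> 'e \<Rightarrow> 'e) \<Rightarrow> bool" where
  "psi_connection k A L \<alpha> E \<psi> nab \<longleftrightarrow>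
     \<psi> \<in> End_A A E \<and>
     nab \<in> lin_maps A L (End_k k A E) \<inter> extensional (carrier L) \<and>
     (\<forall>x\<in>carrier L. \<forall>a\<in>carrier A. \<forall>e\<in>carrier E.
        nab x (a \<odot>\<^bsub>E\<^esub> e) = a \<odot>\<^bsub>E\<^esub> nab x e \<oplus>\<^bsub>E\<^esub> \<alpha> x a \<odot>\<^bsub>E\<^esub> \<psi> e)"

definition id_on :: "('e, 'r) ring_scheme \<Rightarrow> 'e \<Rightarrow> 'e" where
  "id_on E = (\<lambda>e\<in>carrier E. e)"

definition lr_connection ::
  "('k, 'z) ring_scheme \<Rightarrow> ('k, 'a, 'q) module_scheme \<Rightarrow> ('a, 'l) lie_module \<Rightarrow> ('l \<Rightarrow> 'a \<Rightarrow> 'a) \<Rightarrow>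
   ('a, 'e) module \<Rightarrow> ('l \<Rightarrow> 'e \<Rightarrow> 'e) \<Rightarrow> bool" where
  "lr_connection k A L \<alpha> E nab \<longleftrightarrow> psi_connection k A L \<alpha> E (id_on E) nab"

definition curvature ::
  "('s, 'u, 'r) lie_module_scheme \<Rightarrow> ('a, 'e) module \<Rightarrow> ('u \<Rightarrow> 'e \<Rightarrow> 'e) \<Rightarrow> 'u \<Rightarrow> 'u \<Rightarrow> 'e \<Rightarrow> 'e" where
  "curvature U E \<sigma> u v =
     (\<lambda>e\<in>carrier E. commutator E (\<sigma> u) (\<sigma> v) e \<ominus>\<^bsub>E\<^esub> \<sigma> (lbr U u v) e)"


section \<open>The categories of connections, and the functor between them\<close>

text \<open>\<open>'e\<close> is the universe from which the underlying sets of the modules \<open>E\<close> are taken.\<close>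

definition Conn ::
  "('k, 'z) ring_scheme \<Rightarrow> ('k, 'a, 'q) module_scheme \<Rightarrow>
   ((('a \<times> 'a) \<Rightarrow>\<^sub>0 int) set set, 'u) lie_module \<Rightarrow>
   (('a, 'e) module \<times> ('u \<Rightarrow> 'e \<Rightarrow> 'e), 'e \<Rightarrow> 'e) precat" where
  "Conn k A U = \<lparr>
     obj = {(E, \<rho>). module A E \<and> parts_connection k A U E \<rho>},
     hom_set = (\<lambda>(E, \<rho>) (F, \<rho>'). {\<phi> \<in> lin_maps A E F \<inter> extensional (carrier E).
       \<forall>u\<in>carrier U. \<forall>e\<in>carrier E. \<rho>' u (\<phi> e) = \<phi> (\<rho> u e)}),
     cat_id = (\<lambda>(E, \<rho>). id_on E),
     cat_comp = (\<lambda>(E, \<rho>) _ _ g f. compose (carrier E) g f)\<rparr>"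

definition Conn_End ::
  "('k, 'z) ring_scheme \<Rightarrow> ('k, 'a, 'q) module_scheme \<Rightarrow> ('a, 'l) lie_module \<Rightarrow> ('l \<Rightarrow> 'a \<Rightarrow> 'a) \<Rightarrow>
   (('a, 'e) module \<times> ('e \<Rightarrow> 'e) \<times> ('l \<Rightarrow> 'e \<Rightarrow> 'e), 'e \<Rightarrow> 'e) precat" where
  "Conn_End k A L \<alpha> = \<lparr>
     obj = {(E, \<psi>, nab). module A E \<and> psi_connection k A L \<alpha> E \<psi> nab},
     hom_set = (\<lambda>(E, \<psi>, nab) (F, \<psi>', nab'). {\<phi> \<in> lin_maps A E F \<inter> extensional (carrier E).
       (\<forall>x\<in>carrier L. \<forall>e\<in>carrier E. \<phi> (nab x e) = nab' x (\<phi> e)) \<and>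
       (\<forall>e\<in>carrier E. \<phi> (\<psi> e) = \<psi>' (\<phi> e))}),
     cat_id = (\<lambda>(E, \<psi>, nab). id_on E),
     cat_comp = (\<lambda>(E, \<psi>, nab) _ _ g f. compose (carrier E) g f)\<rparr>"

text \<open>The object part of \<open>C\<^sub>f\<close>. The formula for \<open>\<rho>\<close> does not involve \<open>f\<close>, which enters
  only through the target category.\<close>

definition Cf_obj ::
  "('k, 'a, 'q) module_scheme \<Rightarrow> ('a, 'l) lie_module \<Rightarrow>
   ('a, 'e) module \<times> ('e \<Rightarrow> 'e) \<times> ('l \<Rightarrow> 'e \<Rightarrow> 'e) \<Rightarrow>
   ('a, 'e) module \<times> ('a \<times> 'l \<Rightarrow> 'e \<Rightarrow> 'e)" where
  "Cf_obj A L = (\<lambda>(E, \<psi>, nab). (E, \<lambda>(a, x) \<in> carrier A \<times> carrier L.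
     \<lambda>e\<in>carrier E. a \<odot>\<^bsub>E\<^esub> \<psi> e \<oplus>\<^bsub>E\<^esub> nab x e))"

definition Cf_mor :: "'o \<Rightarrow> 'o \<Rightarrow> ('e \<Rightarrow> 'e) \<Rightarrow> 'e \<Rightarrow> 'e" where
  "Cf_mor X Y \<phi> = \<phi>"

end

theory Submission
  imports Defs
begin

text \<open>The action of the principal parts on an abelian group \<open>M\<close> with commuting left and right
  actions of \<open>A\<close> is well defined on an element \<open>u\<close> as soon as every \<open>ub - bu\<close> is central, that
  is, killed by \<open>I\<close>: if \<open>w\<close> lies in \<open>I\<close>, then \<open>wu\<close> is again central, hence killed by every
  other element of \<open>I\<close>. All elements of \<open>L(f\<^sup>\<alpha>)\<close> have this property, and for \<open>\<delta>\<close> in \<open>End\<^sub>k(E)\<close>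
  it says that \<open>\<delta>\<close> has order at most one. A map is thus linear over the principal parts iff it
  respects the left and right actions of \<open>A\<close>. In \<open>L(f\<^sup>\<alpha>)\<close> one has \<open>zc = cz\<close> and
  \<open>xc = \<alpha>(x)(c)z + cx\<close>, so that respecting the right action means that \<open>\<psi> = \<rho>(z)\<close> is \<open>A\<close>-linear and that
  \<open>\<nabla> = \<rho>|\<^sub>L\<close> satisfies the Leibniz rule with \<open>\<psi>\<close>. Hence \<open>C\<^sub>f\<close> is even an isomorphism of
  categories, with inverse \<open>(E, \<rho>) \<mapsto> (E, \<rho>(z), \<rho>|\<^sub>L)\<close>.\<close>

section \<open>The tensor square and actions of principal parts\<close>

lemma frag_span_induct [consumes 1, case_names zero one diff]:
  assumes "Poly_Mapping.keys c \<subseteq> S" and "P 0" and "\<And>x. x \<in> S \<Longrightarrow> P (frag_of x)"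
    and "\<And>a b. \<lbrakk>Poly_Mapping.keys a \<subseteq> S; Poly_Mapping.keys b \<subseteq> S; P a; P b\<rbrakk> \<Longrightarrow> P (a - b)"
  shows "P c"
proof -
  \<comment> \<open>Carrying the support condition through the induction supplies it for both terms
    of a difference. The actions below are additive only under that condition.\<close>
  have "Poly_Mapping.keys c \<subseteq> S \<and> P c"
    using assms(1)
  proof (induction c rule: frag_induction)
    case (diff a b)
    then show ?case using keys_diff[of a b] assms(4) by blast
  qed (use assms in auto)
  then show ?thesis by blast
qed

context abelian_group
begin

lemma plus_minus: "\<lbrakk>x \<in> carrier G; y \<in> carrier G\<rbrakk> \<Longrightarrow> (x \<oplus> y) \<ominus> y = x"
  by (simp add: a_minus_def a_assoc r_neg)

lemma minus_plus: "\<lbrakk>x \<in> carrier G; y \<in> carrier G\<rbrakk> \<Longrightarrow> (x \<ominus> y) \<oplus> y = x"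
  by (simp add: a_minus_def a_assoc l_neg)

lemma minus_eq_zero_iff:
  assumes "x \<in> carrier G" "y \<in> carrier G"
  shows "x \<ominus> y = \<zero> \<longleftrightarrow> x = y"
proof
  assume "x \<ominus> y = \<zero>"
  then have "\<zero> \<oplus> y = (x \<ominus> y) \<oplus> y" by simp
  then show "x = y" using assms by (simp add: a_minus_def a_assoc l_neg)
qed (use assms in \<open>simp add: a_minus_def r_neg\<close>)

lemma plus_minus_cancel:
  assumes "x \<in> carrier G" "y \<in> carrier G" "z \<in> carrier G"
  shows "(x \<oplus> y) \<ominus> (x \<oplus> z) = y \<ominus> z"
proof -
  have "(x \<oplus> y) \<ominus> (x \<oplus> z) = (x \<oplus> (\<ominus> x)) \<oplus> (y \<oplus> (\<ominus> z))"
    unfolding a_minus_def using assms by (simp only: minus_add a_ac a_closed a_inv_closed)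
  then show ?thesis using assms by (simp add: r_neg a_minus_def)
qed

text \<open>Points outside the support contribute the zeroth multiple of \<open>h p\<close>. Two
  formal sums can thus be extended over one common index set, which gives additivity.\<close>

lemma frag_lift_superset:
  assumes "finite S" "Poly_Mapping.keys w \<subseteq> S" "h \<in> S \<rightarrow> carrier G"
  shows "frag_lift G h w = (\<Oplus>p\<in>S. [Poly_Mapping.lookup w p] \<cdot>\<^bsub>G\<^esub> h p)"
  unfolding frag_lift_def
proof (rule add.finprod_mono_neutral_cong_left)
  show "[Poly_Mapping.lookup w p] \<cdot>\<^bsub>G\<^esub> h p = \<zero>" if "p \<in> S - Poly_Mapping.keys w" for p
    using that by (simp add: in_keys_iff add_pow_def)
qed (use assms in auto)

lemma frag_lift_closed:
  assumes "Poly_Mapping.keys w \<subseteq> S" "h \<in> S \<rightarrow> carrier G"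
  shows "frag_lift G h w \<in> carrier G"
  unfolding frag_lift_def using assms by (intro finsum_closed) auto

lemma frag_lift_add:
  assumes "Poly_Mapping.keys v \<subseteq> S" "Poly_Mapping.keys w \<subseteq> S" "h \<in> S \<rightarrow> carrier G"
  shows "frag_lift G h (v + w) = frag_lift G h v \<oplus> frag_lift G h w"
proof -
  let ?K = "Poly_Mapping.keys v \<union> Poly_Mapping.keys w"
  have h: "h \<in> ?K \<rightarrow> carrier G" using assms by auto
  have "frag_lift G h (v + w) = (\<Oplus>p\<in>?K. [Poly_Mapping.lookup (v + w) p] \<cdot>\<^bsub>G\<^esub> h p)"
    using h Poly_Mapping.keys_add[of v w] by (intro frag_lift_superset) auto
  also have "\<dots> = (\<Oplus>p\<in>?K. [Poly_Mapping.lookup v p] \<cdot>\<^bsub>G\<^esub> h p \<oplus> [Poly_Mapping.lookup w p] \<cdot>\<^bsub>G\<^esub> h p)"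
    using h by (intro finsum_cong') (auto simp: lookup_add Pi_iff intro!: add.int_pow_mult)
  also have "\<dots> = frag_lift G h v \<oplus> frag_lift G h w"
    using h by (subst finsum_addf) (auto simp: frag_lift_superset[of ?K] Pi_iff)
  finally show ?thesis .
qed

text \<open>Additivity applied to \<open>v = (v - w) + w\<close>, which avoids computing with
  negated coefficients.\<close>

lemma frag_lift_diff:
  assumes "Poly_Mapping.keys v \<subseteq> S" "Poly_Mapping.keys w \<subseteq> S" "h \<in> S \<rightarrow> carrier G"
  shows "frag_lift G h (v - w) = frag_lift G h v \<ominus> frag_lift G h w"
proof -
  have k: "Poly_Mapping.keys (v - w) \<subseteq> S" using keys_diff[of v w] assms by blast
  have "frag_lift G h v = frag_lift G h (v - w) \<oplus> frag_lift G h w"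
    using frag_lift_add[OF k assms(2,3)] by simp
  then show ?thesis
    using frag_lift_closed[OF k assms(3)] frag_lift_closed[OF assms(2,3)]
    by (simp add: a_minus_def a_assoc r_neg)
qed

lemma frag_lift_0: "frag_lift G h 0 = \<zero>"
  by (simp add: frag_lift_def)

lemma frag_lift_of: "h p \<in> carrier G \<Longrightarrow> frag_lift G h (frag_of p) = h p"
  by (simp add: frag_lift_def)

lemma frag_lift_cong:
  assumes "\<And>p. p \<in> Poly_Mapping.keys w \<Longrightarrow> h p = h' p"
    and "h' \<in> Poly_Mapping.keys w \<rightarrow> carrier G"
  shows "frag_lift G h w = frag_lift G h' w"
  unfolding frag_lift_def using assms by (intro finsum_cong') (auto simp: Pi_iff)

end

section \<open>The ring of formal sums of pairs and its quotient, the tensor square\<close>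

abbreviation formal_sums :: "('k, 'a, 'q) module_scheme \<Rightarrow> (('a \<times> 'a) \<Rightarrow>\<^sub>0 int) set" where
  "formal_sums A \<equiv> {w. Poly_Mapping.keys w \<subseteq> carrier A \<times> carrier A}"

lemma formal_sums_diff: "v \<in> formal_sums A \<Longrightarrow> w \<in> formal_sums A \<Longrightarrow> v - w \<in> formal_sums A"
  using keys_diff[of v w] by blast

lemma formal_sums_add: "v \<in> formal_sums A \<Longrightarrow> w \<in> formal_sums A \<Longrightarrow> v + w \<in> formal_sums A"
  using Poly_Mapping.keys_add[of v w] by blast

locale tensor_square =
  fixes k :: "('k, 'z) ring_scheme" and A :: "('k, 'a, 'q) module_scheme"
  assumes is_algebra: "algebra k A"
begin

sublocale A: cring A
  using is_algebra by (rule algebra.M_cring)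

lemma scal_closed: "c \<in> carrier k \<Longrightarrow> a \<in> carrier A \<Longrightarrow> c \<odot>\<^bsub>A\<^esub> a \<in> carrier A"
  by (rule module.smult_closed[OF algebra.module[OF is_algebra]])

lemma struct_map_closed: "c \<in> carrier k \<Longrightarrow> struct_map A c \<in> carrier A"
  by (simp add: struct_map_def scal_closed)

text \<open>Multiplication by a scalar of \<open>k\<close> becomes multiplication inside
  \<open>A\<close> by its image, so that relations over \<open>k\<close> can be handled through the
  actions of \<open>A\<close> alone.\<close>

lemma scal_eq: "c \<in> carrier k \<Longrightarrow> a \<in> carrier A \<Longrightarrow> c \<odot>\<^bsub>A\<^esub> a = struct_map A c \<otimes>\<^bsub>A\<^esub> a"
  using algebra.smult_assoc2[OF is_algebra, of c "\<one>\<^bsub>A\<^esub>" a] by (simp add: struct_map_def)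

abbreviation pmult :: "(('a \<times> 'a) \<Rightarrow>\<^sub>0 int) \<Rightarrow> (('a \<times> 'a) \<Rightarrow>\<^sub>0 int) \<Rightarrow> (('a \<times> 'a) \<Rightarrow>\<^sub>0 int)" where
  "pmult \<equiv> monoid.mult (pair_ring A)"

lemma pmult_0: "pmult 0 w = 0" "pmult w 0 = 0"
  by (auto simp: pair_ring_def frag_extend_eq_0)

lemma pmult_diff_left: "pmult (v - v') w = pmult v w - pmult v' w"
  by (simp add: pair_ring_def frag_extend_diff)

text \<open>The left factor is extended on the outside and the right factor on the inside of the
  definition. Only additivity on the left is immediate; additivity on the right is first reduced to
  a single generator as left factor.\<close>

lemma pmult_diff_right: "pmult v (w - w') = pmult v w - pmult v w'"
proof -
  have "Poly_Mapping.keys v \<subseteq> UNIV" by simp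
  then show ?thesis
    by (induction v rule: frag_span_induct)
      (auto simp: pmult_0 pmult_diff_left, auto simp: pair_ring_def frag_extend_diff)
qed

lemma pmult_of: "pmult (frag_of (a, b)) (frag_of (a', b')) = frag_of (a \<otimes>\<^bsub>A\<^esub> a', b \<otimes>\<^bsub>A\<^esub> b')"
  by (simp add: pair_ring_def)

lemma pmult_closed:
  assumes "v \<in> formal_sums A" "w \<in> formal_sums A"
  shows "pmult v w \<in> formal_sums A"
proof -
  have "Poly_Mapping.keys v \<subseteq> carrier A \<times> carrier A" using assms(1) by simp
  then show ?thesis
  proof (induction v rule: frag_span_induct)
    case (one x)
    have "Poly_Mapping.keys w \<subseteq> carrier A \<times> carrier A" using assms(2) by simp
    then show ?case
    proof (induction w rule: frag_span_induct)
      case (one y)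
      then show ?case using \<open>x \<in> _\<close> by (cases x, cases y) (simp add: pmult_of)
    next
      case (diff w w')
      then show ?case unfolding pmult_diff_right by (rule_tac formal_sums_diff)
    qed (simp add: pmult_0)
  next
    case (diff v v')
    then show ?case unfolding pmult_diff_left by (rule_tac formal_sums_diff)
  qed (simp add: pmult_0)
qed

text \<open>Both sides are additive in each of the three factors. The nested inductions leave only
  generators, where associativity of \<open>A\<close> is used in each coordinate.\<close>

lemma pmult_assoc:
  assumes "u \<in> formal_sums A" "v \<in> formal_sums A" "w \<in> formal_sums A"
  shows "pmult (pmult u v) w = pmult u (pmult v w)"
proof -
  have u: "Poly_Mapping.keys u \<subseteq> carrier A \<times> carrier A"
    and v: "Poly_Mapping.keys v \<subseteq> carrier A \<times> carrier A"
    and w: "Poly_Mapping.keys w \<subseteq> carrier A \<times> carrier A" using assms by auto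
  from u show ?thesis
  proof (induction u rule: frag_span_induct)
    case x: (one x)
    from v show ?case
    proof (induction v rule: frag_span_induct)
      case y: (one y)
      from w show ?case
      proof (induction w rule: frag_span_induct)
        case z: (one z)
        show ?case using x y z
          by (cases x, cases y, cases z) (simp add: pmult_of A.m_assoc)
      qed (simp_all add: pmult_0 pmult_diff_left pmult_diff_right)
    qed (simp_all add: pmult_0 pmult_diff_left pmult_diff_right)
  qed (simp_all add: pmult_0 pmult_diff_left pmult_diff_right)
qed

lemma pmult_one:
  assumes "v \<in> formal_sums A"
  shows "pmult (frag_of (\<one>\<^bsub>A\<^esub>, \<one>\<^bsub>A\<^esub>)) v = v" and "pmult v (frag_of (\<one>\<^bsub>A\<^esub>, \<one>\<^bsub>A\<^esub>)) = v"
proof -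
  have v: "Poly_Mapping.keys v \<subseteq> carrier A \<times> carrier A" using assms by simp
  from v show "pmult (frag_of (\<one>\<^bsub>A\<^esub>, \<one>\<^bsub>A\<^esub>)) v = v"
    by (induction v rule: frag_span_induct) (auto simp: pmult_0 pmult_diff_right pmult_of)
  from v show "pmult v (frag_of (\<one>\<^bsub>A\<^esub>, \<one>\<^bsub>A\<^esub>)) = v"
    by (induction v rule: frag_span_induct) (auto simp: pmult_0 pmult_diff_left pmult_of)
qed

lemma pair_ring_simps:
  "carrier (pair_ring A) = formal_sums A" "\<one>\<^bsub>pair_ring A\<^esub> = frag_of (\<one>\<^bsub>A\<^esub>, \<one>\<^bsub>A\<^esub>)"
  "\<zero>\<^bsub>pair_ring A\<^esub> = 0" "v \<oplus>\<^bsub>pair_ring A\<^esub> w = v + w"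
  by (simp_all add: pair_ring_def)

lemma pmult_add_left: "pmult (v + v') w = pmult v w + pmult v' w"
  by (simp add: pair_ring_def frag_extend_add)

lemma pmult_add_right: "pmult v (w + w') = pmult v w + pmult v w'"
  using pmult_diff_right[of v "w + w'" w'] by simp

lemma ring_pair_ring: "ring (pair_ring A)"
proof (rule ringI)
  show "abelian_group (pair_ring A)"
  proof (rule abelian_groupI)
    show "\<exists>y\<in>carrier (pair_ring A). y \<oplus>\<^bsub>pair_ring A\<^esub> x = \<zero>\<^bsub>pair_ring A\<^esub>"
      if "x \<in> carrier (pair_ring A)" for x
      using that by (intro bexI[of _ "- x"]) (auto simp: pair_ring_simps)
  next
    show "v \<oplus>\<^bsub>pair_ring A\<^esub> w \<in> carrier (pair_ring A)"
      if "v \<in> carrier (pair_ring A)" "w \<in> carrier (pair_ring A)" for v w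
      using that formal_sums_add[of v A w] by (simp add: pair_ring_simps)
  qed (auto simp: pair_ring_simps add.assoc add.commute)
  show "monoid (pair_ring A)"
    using pmult_closed by (intro monoidI) (simp_all add: pair_ring_simps pmult_assoc pmult_one)
qed (simp_all add: pair_ring_simps pmult_add_left pmult_add_right)

abbreviation rel_ideal :: "(('a \<times> 'a) \<Rightarrow>\<^sub>0 int) set" where
  "rel_ideal \<equiv> genideal (pair_ring A) (tensor_rels k A)"

lemma tensor_rels_closed: "tensor_rels k A \<subseteq> formal_sums A"
proof
  have of: "frag_of (a, b) \<in> formal_sums A" if "a \<in> carrier A" "b \<in> carrier A" for a b
    using that by simp
  fix w
  assume "w \<in> tensor_rels k A"
  then show "w \<in> formal_sums A"
    unfolding tensor_rels_def
    by (elim UnE CollectE exE conjE) (simp only:, (intro formal_sums_diff of; simp add: scal_closed))+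
qed

lemma ideal_rel_ideal: "ideal rel_ideal (pair_ring A)"
  by (rule ring.genideal_ideal[OF ring_pair_ring]) (simp add: pair_ring_simps(1) tensor_rels_closed)

lemma tensor_sq_ring: "ring (tensor_sq k A)"
  unfolding tensor_sq_def by (rule ideal.quotient_is_ring[OF ideal_rel_ideal])

text \<open>The coset of \<open>rel_ideal\<close> through \<open>w\<close>, that is, the tensor
  represented by \<open>w\<close>, as an explicit set of representatives on which maps can be
  evaluated.\<close>

definition tclass :: "(('a \<times> 'a) \<Rightarrow>\<^sub>0 int) \<Rightarrow> (('a \<times> 'a) \<Rightarrow>\<^sub>0 int) set" where
  "tclass w = (\<lambda>j. j + w) ` rel_ideal"

definition sq_ideal :: "(('a \<times> 'a) \<Rightarrow>\<^sub>0 int) set set" where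
  "sq_ideal = ideal_prod (tensor_sq k A) (diag_ideal k A) (diag_ideal k A)"

text \<open>The class in the principal parts of the tensor of \<open>w\<close>: a coset whose
  members are themselves cosets. Its union consists of formal sums representing that class, and
  \<open>parts_smult\<close> ranges over this union.\<close>

definition pclass :: "(('a \<times> 'a) \<Rightarrow>\<^sub>0 int) \<Rightarrow> (('a \<times> 'a) \<Rightarrow>\<^sub>0 int) set set" where
  "pclass w = (\<lambda>t. {x + y | x y. x \<in> t \<and> y \<in> tclass w}) ` sq_ideal"

lemma rel_ideal_closed: "rel_ideal \<subseteq> formal_sums A"
  using additive_subgroup.a_subset[OF ideal.axioms(1)[OF ideal_rel_ideal]] by (simp add: pair_ring_simps)

lemma zero_rel_ideal: "0 \<in> rel_ideal"
  using additive_subgroup.zero_closed[OF ideal.axioms(1)[OF ideal_rel_ideal]] by (simp add: pair_ring_simps)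

lemma a_r_coset_rel_ideal: "rel_ideal +>\<^bsub>pair_ring A\<^esub> w = tclass w"
  by (auto simp: a_r_coset_def' tclass_def pair_ring_simps)

lemma carrier_tensor_sq: "carrier (tensor_sq k A) = tclass ` formal_sums A"
  by (auto simp: tensor_sq_def FactRing_def A_RCOSETS_def' a_r_coset_rel_ideal pair_ring_simps)

lemma zero_tensor_sq: "\<zero>\<^bsub>tensor_sq k A\<^esub> = rel_ideal"
  by (simp add: tensor_sq_def FactRing_def)

lemma add_tensor_sq: "s \<oplus>\<^bsub>tensor_sq k A\<^esub> t = {x + y | x y. x \<in> s \<and> y \<in> t}"
  by (auto simp: tensor_sq_def FactRing_def set_add_def' pair_ring_simps)

lemma mult_tensor_sq: "s \<otimes>\<^bsub>tensor_sq k A\<^esub> t = (\<Union>x\<in>s. \<Union>y\<in>t. tclass (pmult x y))"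
  by (auto simp: tensor_sq_def FactRing_def rcoset_mult_def a_r_coset_rel_ideal)

lemma carrier_princ_parts: "carrier (princ_parts k A) = pclass ` formal_sums A"
  unfolding princ_parts_def FactRing_def A_RCOSETS_def' a_r_coset_def' pclass_def sq_ideal_def
  by (auto simp: carrier_tensor_sq add_tensor_sq)

lemma self_tclass: "w \<in> tclass w"
  using zero_rel_ideal by (force simp: tclass_def)

lemma tclass_closed: "w \<in> formal_sums A \<Longrightarrow> tclass w \<subseteq> formal_sums A"
  using rel_ideal_closed formal_sums_add unfolding tclass_def by blast

end

section \<open>Commuting left and right actions of \<open>A\<close>, that is, modules over the
  tensor square\<close>

locale bimodule = tensor_square k A + M: abelian_group M
  for k :: "('k, 'z) ring_scheme" and A :: "('k, 'a, 'q) module_scheme"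
    and M :: "('m, 'r) ring_scheme" +
  fixes l :: "'a \<Rightarrow> 'm \<Rightarrow> 'm" and r :: "'m \<Rightarrow> 'a \<Rightarrow> 'm"
  assumes l_closed: "\<lbrakk>a \<in> carrier A; u \<in> carrier M\<rbrakk> \<Longrightarrow> l a u \<in> carrier M"
    and r_closed: "\<lbrakk>a \<in> carrier A; u \<in> carrier M\<rbrakk> \<Longrightarrow> r u a \<in> carrier M"
    and l_add: "\<lbrakk>a \<in> carrier A; u \<in> carrier M; v \<in> carrier M\<rbrakk> \<Longrightarrow> l a (u \<oplus>\<^bsub>M\<^esub> v) = l a u \<oplus>\<^bsub>M\<^esub> l a v"
    and r_add: "\<lbrakk>a \<in> carrier A; u \<in> carrier M; v \<in> carrier M\<rbrakk> \<Longrightarrow> r (u \<oplus>\<^bsub>M\<^esub> v) a = r u a \<oplus>\<^bsub>M\<^esub> r v a"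
    and l_add_scal: "\<lbrakk>a \<in> carrier A; b \<in> carrier A; u \<in> carrier M\<rbrakk>
      \<Longrightarrow> l (a \<oplus>\<^bsub>A\<^esub> b) u = l a u \<oplus>\<^bsub>M\<^esub> l b u"
    and r_add_scal: "\<lbrakk>a \<in> carrier A; b \<in> carrier A; u \<in> carrier M\<rbrakk>
      \<Longrightarrow> r u (a \<oplus>\<^bsub>A\<^esub> b) = r u a \<oplus>\<^bsub>M\<^esub> r u b"
    and l_mult: "\<lbrakk>a \<in> carrier A; b \<in> carrier A; u \<in> carrier M\<rbrakk> \<Longrightarrow> l (a \<otimes>\<^bsub>A\<^esub> b) u = l a (l b u)"
    and r_mult: "\<lbrakk>a \<in> carrier A; b \<in> carrier A; u \<in> carrier M\<rbrakk> \<Longrightarrow> r u (a \<otimes>\<^bsub>A\<^esub> b) = r (r u a) b"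
    and l_one: "u \<in> carrier M \<Longrightarrow> l \<one>\<^bsub>A\<^esub> u = u"
    and r_one: "u \<in> carrier M \<Longrightarrow> r u \<one>\<^bsub>A\<^esub> = u"
    and l_r: "\<lbrakk>a \<in> carrier A; b \<in> carrier A; u \<in> carrier M\<rbrakk> \<Longrightarrow> r (l a u) b = l a (r u b)"
    and balanced: "\<lbrakk>c \<in> carrier k; u \<in> carrier M\<rbrakk> \<Longrightarrow> l (struct_map A c) u = r u (struct_map A c)"
begin

text \<open>The action of a representative, before passing to the tensor square or to the principal
  parts.\<close>

definition act :: "(('a \<times> 'a) \<Rightarrow>\<^sub>0 int) \<Rightarrow> 'm \<Rightarrow> 'm" where
  "act w u = frag_lift M (\<lambda>(a, b). l a (r u b)) w"

lemma act_funcset: "u \<in> carrier M \<Longrightarrow> (\<lambda>(a, b). l a (r u b)) \<in> carrier A \<times> carrier A \<rightarrow> carrier M"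
  by (auto intro: l_closed r_closed)

lemma act_closed: "w \<in> formal_sums A \<Longrightarrow> u \<in> carrier M \<Longrightarrow> act w u \<in> carrier M"
  unfolding act_def by (rule M.frag_lift_closed[OF _ act_funcset]) auto

lemma act_diff: "\<lbrakk>v \<in> formal_sums A; w \<in> formal_sums A; u \<in> carrier M\<rbrakk>
    \<Longrightarrow> act (v - w) u = act v u \<ominus>\<^bsub>M\<^esub> act w u"
  unfolding act_def by (rule M.frag_lift_diff[OF _ _ act_funcset]) auto

lemma act_add: "\<lbrakk>v \<in> formal_sums A; w \<in> formal_sums A; u \<in> carrier M\<rbrakk>
    \<Longrightarrow> act (v + w) u = act v u \<oplus>\<^bsub>M\<^esub> act w u"
  unfolding act_def by (rule M.frag_lift_add[OF _ _ act_funcset]) auto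

lemma act_0: "act 0 u = \<zero>\<^bsub>M\<^esub>"
  by (simp add: act_def M.frag_lift_0)

lemma act_of: "\<lbrakk>a \<in> carrier A; b \<in> carrier A; u \<in> carrier M\<rbrakk> \<Longrightarrow> act (frag_of (a, b)) u = l a (r u b)"
  by (simp add: act_def M.frag_lift_of l_closed r_closed)

lemma l_zero: "a \<in> carrier A \<Longrightarrow> l a \<zero>\<^bsub>M\<^esub> = \<zero>\<^bsub>M\<^esub>"
  using l_add[of a "\<zero>\<^bsub>M\<^esub>" "\<zero>\<^bsub>M\<^esub>"] l_closed[of a "\<zero>\<^bsub>M\<^esub>"] by (simp add: M.add.l_cancel_one')

lemma r_zero: "a \<in> carrier A \<Longrightarrow> r \<zero>\<^bsub>M\<^esub> a = \<zero>\<^bsub>M\<^esub>"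
  using r_add[of a "\<zero>\<^bsub>M\<^esub>" "\<zero>\<^bsub>M\<^esub>"] r_closed[of a "\<zero>\<^bsub>M\<^esub>"] by (simp add: M.add.l_cancel_one')

lemma l_zero_scal: "u \<in> carrier M \<Longrightarrow> l \<zero>\<^bsub>A\<^esub> u = \<zero>\<^bsub>M\<^esub>"
  using l_add_scal[of "\<zero>\<^bsub>A\<^esub>" "\<zero>\<^bsub>A\<^esub>" u] l_closed[of "\<zero>\<^bsub>A\<^esub>" u] by (simp add: M.add.l_cancel_one')

lemma l_minus: "\<lbrakk>a \<in> carrier A; u \<in> carrier M; v \<in> carrier M\<rbrakk> \<Longrightarrow> l a (u \<ominus>\<^bsub>M\<^esub> v) = l a u \<ominus>\<^bsub>M\<^esub> l a v"
  using l_add[of a "u \<ominus>\<^bsub>M\<^esub> v" v] by (simp add: M.minus_plus l_closed M.plus_minus)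

lemma r_minus: "\<lbrakk>a \<in> carrier A; u \<in> carrier M; v \<in> carrier M\<rbrakk> \<Longrightarrow> r (u \<ominus>\<^bsub>M\<^esub> v) a = r u a \<ominus>\<^bsub>M\<^esub> r v a"
  using r_add[of a "u \<ominus>\<^bsub>M\<^esub> v" v] by (simp add: M.minus_plus r_closed M.plus_minus)

lemma l_minus_scal: "\<lbrakk>a \<in> carrier A; b \<in> carrier A; u \<in> carrier M\<rbrakk>
    \<Longrightarrow> l (a \<ominus>\<^bsub>A\<^esub> b) u = l a u \<ominus>\<^bsub>M\<^esub> l b u"
  using l_add_scal[of "a \<ominus>\<^bsub>A\<^esub> b" b u]
  by (simp add: a_minus_def[of A] A.a_assoc A.l_neg l_closed M.plus_minus)

lemma act_l: "\<lbrakk>w \<in> formal_sums A; a \<in> carrier A; u \<in> carrier M\<rbrakk> \<Longrightarrow> act w (l a u) = l a (act w u)"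
proof -
  assume w: "w \<in> formal_sums A" and [simp]: "a \<in> carrier A" "u \<in> carrier M"
  from w have "Poly_Mapping.keys w \<subseteq> carrier A \<times> carrier A" by simp
  then show ?thesis
  proof (induction w rule: frag_span_induct)
    case (one p)
    then show ?case
      by (cases p) (simp add: act_of l_closed r_closed l_r flip: l_mult, simp add: A.m_comm)
  next
    case (diff v w)
    then show ?case by (simp add: act_diff l_closed l_minus act_closed)
  qed (simp add: act_0 l_zero)
qed

lemma act_minus: "\<lbrakk>w \<in> formal_sums A; u \<in> carrier M; v \<in> carrier M\<rbrakk>
    \<Longrightarrow> act w (u \<ominus>\<^bsub>M\<^esub> v) = act w u \<ominus>\<^bsub>M\<^esub> act w v"
proof -
  assume w: "w \<in> formal_sums A" and [simp]: "u \<in> carrier M" "v \<in> carrier M"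
  from w have "Poly_Mapping.keys w \<subseteq> carrier A \<times> carrier A" by simp
  then show ?thesis
  proof (induction w rule: frag_span_induct)
    case (one p)
    then show ?case
      by (cases p) (simp add: act_of l_closed r_closed r_minus l_minus)
  next
    case (diff w w')
    then show ?case
      by (simp add: act_diff act_closed)
        (simp add: a_minus_def M.minus_add M.a_ac act_closed)
  next
    case zero
    have "\<zero>\<^bsub>M\<^esub> \<ominus>\<^bsub>M\<^esub> \<zero>\<^bsub>M\<^esub> = \<zero>\<^bsub>M\<^esub>" by (simp only: a_minus_def M.r_neg M.zero_closed)
    then show ?case by (simp add: act_0)
  qed
qed

text \<open>Zero is the zero multiple of itself, and \<open>act_l\<close> pulls this zero scalar out
  of the action.\<close>

lemma act_zero: "w \<in> formal_sums A \<Longrightarrow> act w \<zero>\<^bsub>M\<^esub> = \<zero>\<^bsub>M\<^esub>"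
  using act_l[of w "\<zero>\<^bsub>A\<^esub>" "\<zero>\<^bsub>M\<^esub>"] by (simp add: l_zero_scal l_zero act_closed)

text \<open>By additivity in both factors only generators matter. There the left and right actions
  commute, and commutativity of \<open>A\<close> corrects the order in which the two right factors
  are applied.\<close>

lemma act_pmult:
  assumes "v \<in> formal_sums A" "w \<in> formal_sums A" and u: "u \<in> carrier M"
  shows "act (pmult v w) u = act v (act w u)"
proof -
  have v: "Poly_Mapping.keys v \<subseteq> carrier A \<times> carrier A"
    and w: "Poly_Mapping.keys w \<subseteq> carrier A \<times> carrier A" using assms by auto
  from v show ?thesis
  proof (induction v rule: frag_span_induct)
    case x: (one x)
    from w show ?case
    proof (induction w rule: frag_span_induct)
      case (one y)
      obtain a b where [simp]: "x = (a, b)" "a \<in> carrier A" "b \<in> carrier A" using x by auto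
      obtain a' b' where [simp]: "y = (a', b')" "a' \<in> carrier A" "b' \<in> carrier A" using one by auto
      show ?case
        using u by (simp add: pmult_of act_of l_closed r_closed l_mult l_r A.m_comm[of b b'] r_mult)
    next
      case (diff w w')
      then show ?case
        using x u pmult_closed[of "frag_of x" w] pmult_closed[of "frag_of x" w']
        by (simp add: pmult_diff_right act_diff act_closed act_minus)
    qed (use x in \<open>simp add: pmult_0 act_0 act_zero\<close>)
  next
    case (diff v v')
    then show ?case
      using u w pmult_closed[of v w] pmult_closed[of v' w]
      by (simp add: pmult_diff_left act_diff act_closed)
  qed (simp add: pmult_0 act_0)
qed

text \<open>\<open>balanced\<close> lets a scalar of \<open>k\<close> pass from the left action to
  the right one. This is the relation \<open>ca \<otimes> b = a \<otimes> cb\<close> of the tensor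
  product over \<open>k\<close>, seen through the action.\<close>

lemma act_scal_left:
  assumes "c \<in> carrier k" "a \<in> carrier A" "b \<in> carrier A" "u \<in> carrier M"
  shows "l (c \<odot>\<^bsub>A\<^esub> a) (r u b) = l a (r u (c \<odot>\<^bsub>A\<^esub> b))"
  using assms
  by (simp add: scal_eq struct_map_closed A.m_comm[of "struct_map A c" a]
      A.m_comm[of "struct_map A c" b] l_mult r_mult r_closed balanced)

lemma act_tensor_rels:
  assumes "w \<in> tensor_rels k A" "u \<in> carrier M"
  shows "act w u = \<zero>\<^bsub>M\<^esub>"
proof -
  have of: "frag_of (a, b) \<in> formal_sums A" if "a \<in> carrier A" "b \<in> carrier A" for a b
    using that by simp
  have cancel: "(x \<oplus>\<^bsub>M\<^esub> y) \<ominus>\<^bsub>M\<^esub> x \<ominus>\<^bsub>M\<^esub> y = \<zero>\<^bsub>M\<^esub>" if "x \<in> carrier M" "y \<in> carrier M" for x y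
    using that by (simp add: M.a_comm[of x y] M.plus_minus) (simp add: a_minus_def M.r_neg)
  show ?thesis
    using assms(1) unfolding tensor_rels_def
  proof (elim UnE CollectE exE conjE, goal_cases)
    case (1 a a' b)
    then show ?case using assms(2)
      by (simp only: act_diff of formal_sums_diff A.a_closed act_of l_add_scal r_closed l_closed cancel)
  next
    case (2 a b b')
    then show ?case using assms(2)
      by (simp only: act_diff of formal_sums_diff A.a_closed act_of r_add_scal l_add r_closed l_closed cancel)
  next
    case (3 c a b)
    then show ?case using assms(2)
      by (simp only: act_diff of scal_closed act_of act_scal_left r_closed l_closed
          a_minus_def M.r_neg)
  qed
qed

text \<open>The formal sums that annihilate \<open>M\<close> form an ideal containing the relations,
  hence containing the ideal generated by them.\<close>

lemma act_rel_ideal: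
  assumes "w \<in> rel_ideal" "u \<in> carrier M"
  shows "act w u = \<zero>\<^bsub>M\<^esub>"
proof -
  \<comment> \<open>Vanishing is required on all of \<open>M\<close> at once: in the action of
    \<open>pmult a x\<close> on \<open>u\<close>, the sum \<open>a\<close> is applied to
    \<open>act x u\<close> and not to \<open>u\<close>.\<close>
  define K where "K = {w \<in> formal_sums A. \<forall>u\<in>carrier M. act w u = \<zero>\<^bsub>M\<^esub>}"
  have z: "\<zero>\<^bsub>M\<^esub> \<ominus>\<^bsub>M\<^esub> \<zero>\<^bsub>M\<^esub> = \<zero>\<^bsub>M\<^esub>" by (simp add: a_minus_def)
  have "ideal K (pair_ring A)"
  proof (rule idealI[OF ring_pair_ring])
    interpret P: ring "pair_ring A" by (rule ring_pair_ring)
    have inv: "\<ominus>\<^bsub>pair_ring A\<^esub> w = - w" if "w \<in> formal_sums A" for w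
      using that by (intro P.minus_equality) (auto simp: pair_ring_simps)
    show "subgroup K (add_monoid (pair_ring A))"
    proof (rule P.add.subgroupI)
      show "K \<subseteq> carrier (pair_ring A)" by (auto simp: K_def pair_ring_simps)
      have "0 \<in> K" by (simp add: K_def act_0)
      then show "K \<noteq> {}" by blast
      show "\<ominus>\<^bsub>pair_ring A\<^esub> w \<in> K" if "w \<in> K" for w
        using that act_diff[of 0 w] by (auto simp: K_def inv act_0 z)
      show "v \<oplus>\<^bsub>pair_ring A\<^esub> w \<in> K" if "v \<in> K" "w \<in> K" for v w
        using that formal_sums_add[of v A w] by (simp add: K_def pair_ring_simps act_add)
    qed
  next
    fix a x assume "a \<in> K" "x \<in> carrier (pair_ring A)"
    then show "pmult x a \<in> K" "pmult a x \<in> K"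
      using pmult_closed[of x a] pmult_closed[of a x]
      by (simp_all add: K_def pair_ring_simps act_pmult act_zero act_closed)
  qed
  moreover have "tensor_rels k A \<subseteq> K"
    using act_tensor_rels tensor_rels_closed by (auto simp: K_def)
  ultimately have "rel_ideal \<subseteq> K"
    by (rule ring.genideal_minimal[OF ring_pair_ring])
  then show ?thesis using assms by (auto simp: K_def)
qed

lemma act_tclass:
  assumes "w \<in> formal_sums A" "w' \<in> tclass w" "u \<in> carrier M"
  shows "act w' u = act w u"
proof -
  obtain j where j: "j \<in> rel_ideal" "w' = j + w" using assms(2) by (auto simp: tclass_def)
  then have "j \<in> formal_sums A" using rel_ideal_closed by blast
  then show ?thesis
    using assms j by (simp only: act_add act_rel_ideal act_closed M.l_zero)
qed

end

section \<open>The multiplication map on representatives and the square of the diagonal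
  ideal\<close>

context tensor_square
begin

lemma bimodule_self: "bimodule k A A (\<lambda>a u. a \<otimes>\<^bsub>A\<^esub> u) (\<lambda>u a. u \<otimes>\<^bsub>A\<^esub> a)"
  by unfold_locales
    (auto simp: A.r_distr A.l_distr A.m_assoc struct_map_closed intro: A.m_comm)

definition mu :: "(('a \<times> 'a) \<Rightarrow>\<^sub>0 int) \<Rightarrow> 'a" where
  "mu w = frag_lift A (\<lambda>(a, b). a \<otimes>\<^bsub>A\<^esub> b) w"

lemma mu_funcset: "(\<lambda>(a, b). a \<otimes>\<^bsub>A\<^esub> b) \<in> carrier A \<times> carrier A \<rightarrow> carrier A"
  by auto

lemma mu_closed: "w \<in> formal_sums A \<Longrightarrow> mu w \<in> carrier A"
  unfolding mu_def by (rule A.frag_lift_closed[OF _ mu_funcset]) auto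

lemma mu_diff: "\<lbrakk>v \<in> formal_sums A; w \<in> formal_sums A\<rbrakk> \<Longrightarrow> mu (v - w) = mu v \<ominus>\<^bsub>A\<^esub> mu w"
  unfolding mu_def by (rule A.frag_lift_diff[OF _ _ mu_funcset]) auto

lemma mu_0: "mu 0 = \<zero>\<^bsub>A\<^esub>"
  by (simp add: mu_def A.frag_lift_0)

lemma mu_of: "\<lbrakk>a \<in> carrier A; b \<in> carrier A\<rbrakk> \<Longrightarrow> mu (frag_of (a, b)) = a \<otimes>\<^bsub>A\<^esub> b"
  by (simp add: mu_def A.frag_lift_of)

text \<open>Multiplication is the action on the unit when \<open>A\<close> is a bimodule over
  itself, so independence of the representative is an instance of \<open>act_tclass\<close>.\<close>

lemma mu_tclass:
  assumes "w \<in> formal_sums A" "w' \<in> tclass w"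
  shows "mu w' = mu w"
proof -
  interpret S: bimodule k A A "\<lambda>a u. a \<otimes>\<^bsub>A\<^esub> u" "\<lambda>u a. u \<otimes>\<^bsub>A\<^esub> a"
    by (rule bimodule_self)
  have "mu v = S.act v \<one>\<^bsub>A\<^esub>" if "v \<in> formal_sums A" for v
    unfolding mu_def S.act_def using that by (intro A.frag_lift_cong) auto
  then show ?thesis
    using assms S.act_tclass[OF assms] tclass_closed[OF assms(1)] by auto
qed

lemma mult_map_tclass:
  assumes "w \<in> formal_sums A"
  shows "mult_map A (tclass w) = mu w"
proof -
  have "mu ` tclass w = {mu w}"
  proof (intro equalityI image_subsetI subsetI)
    show "mu w' \<in> {mu w}" if "w' \<in> tclass w" for w'
      using mu_tclass[OF assms that] by simp
    show "x \<in> mu ` tclass w" if "x \<in> {mu w}" for x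
      using that self_tclass[of w] by simp
  qed
  then show ?thesis by (simp add: mult_map_def mu_def[abs_def])
qed

lemma diag_ideal_eq: "diag_ideal k A = tclass ` {w \<in> formal_sums A. mu w = \<zero>\<^bsub>A\<^esub>}"
  by (auto simp: diag_ideal_def a_kernel_def' carrier_tensor_sq mult_map_tclass)

text \<open>\<open>rel_ideal\<close> is the zero of the tensor square. The inductive
  \<open>ideal_prod\<close> has clauses only for products and sums, so zero is exhibited as the
  product of zero with itself. This yields that \<open>w\<close> is among the representatives of
  \<open>pclass w\<close>.\<close>

lemma rel_ideal_in_sq_ideal: "rel_ideal \<in> sq_ideal"
proof -
  interpret T: ring "tensor_sq k A" by (rule tensor_sq_ring)
  have "rel_ideal = tclass 0" by (simp add: tclass_def)
  then have "rel_ideal \<in> diag_ideal k A" by (auto simp: diag_ideal_eq mu_0)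
  moreover have "rel_ideal \<otimes>\<^bsub>tensor_sq k A\<^esub> rel_ideal = rel_ideal"
    using T.l_null[OF T.zero_closed] by (simp add: zero_tensor_sq)
  ultimately show ?thesis
    unfolding sq_ideal_def by (metis ideal_prod.prod)
qed

lemma self_pclass: "w \<in> \<Union>(pclass w)"
proof -
  have "0 + w \<in> {x + y | x y. x \<in> rel_ideal \<and> y \<in> tclass w}"
    using zero_rel_ideal self_tclass by blast
  then show ?thesis using rel_ideal_in_sq_ideal by (auto simp: pclass_def)
qed

end

section \<open>Elements on which the principal parts act: order at most one\<close>

context bimodule
begin

text \<open>The condition says that every tensor \<open>1 \<otimes> b - b \<otimes> 1\<close> kills
  \<open>v\<close>; these tensors generate the kernel of the multiplication.\<close>

definition central :: "'m \<Rightarrow> bool" where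
  "central v \<longleftrightarrow> v \<in> carrier M \<and> (\<forall>b\<in>carrier A. r v b = l b v)"

definition first_order :: "'m \<Rightarrow> bool" where
  "first_order u \<longleftrightarrow> u \<in> carrier M \<and> (\<forall>b\<in>carrier A. central (r u b \<ominus>\<^bsub>M\<^esub> l b u))"

lemma central_zero: "central \<zero>\<^bsub>M\<^esub>"
  by (simp add: central_def l_zero r_zero)

lemma central_minus: "central u \<Longrightarrow> central v \<Longrightarrow> central (u \<ominus>\<^bsub>M\<^esub> v)"
  by (simp add: central_def l_minus r_minus)

lemma central_l: "a \<in> carrier A \<Longrightarrow> central v \<Longrightarrow> central (l a v)"
  by (simp add: central_def l_closed l_r flip: l_mult) (simp add: A.m_comm)

text \<open>A generator \<open>a \<otimes> b\<close> acts on a central element as \<open>ab\<close>,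
  so the whole action factors through \<open>mu\<close>. In particular the diagonal ideal kills
  central elements.\<close>

lemma act_central:
  assumes "w \<in> formal_sums A" and v: "central v"
  shows "act w v = l (mu w) v"
proof -
  have w: "Poly_Mapping.keys w \<subseteq> carrier A \<times> carrier A" and [simp]: "v \<in> carrier M"
    using assms by (auto simp: central_def)
  from w show ?thesis
  proof (induction w rule: frag_span_induct)
    case (one p)
    then show ?case
      using v by (cases p) (simp add: act_of mu_of l_mult central_def)
  next
    case (diff x y)
    then show ?case by (simp add: act_diff mu_diff l_minus_scal mu_closed)
  qed (simp add: act_0 mu_0 l_zero_scal)
qed

text \<open>On a generator \<open>(a, b)\<close> the difference is \<open>a(ub - bu)\<close>, a
  multiple of a central element, and central elements are closed under subtraction. When
  \<open>mu w\<close> vanishes, \<open>act w u\<close> itself is therefore central.\<close>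

lemma act_first_order:
  assumes "w \<in> formal_sums A" and u: "first_order u"
  shows "central (act w u \<ominus>\<^bsub>M\<^esub> l (mu w) u)"
proof -
  have w: "Poly_Mapping.keys w \<subseteq> carrier A \<times> carrier A" and [simp]: "u \<in> carrier M"
    using assms by (auto simp: first_order_def)
  from w show ?thesis
  proof (induction w rule: frag_span_induct)
    case zero
    have "\<zero>\<^bsub>M\<^esub> \<ominus>\<^bsub>M\<^esub> \<zero>\<^bsub>M\<^esub> = \<zero>\<^bsub>M\<^esub>" by (simp only: a_minus_def M.r_neg M.zero_closed)
    then show ?case by (simp add: act_0 mu_0 l_zero_scal central_zero)
  next
    case (one p)
    obtain a b where [simp]: "p = (a, b)" "a \<in> carrier A" "b \<in> carrier A" using one by auto
    have "act (frag_of p) u \<ominus>\<^bsub>M\<^esub> l (mu (frag_of p)) u = l a (r u b \<ominus>\<^bsub>M\<^esub> l b u)"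
      by (simp add: act_of mu_of l_mult l_minus r_closed l_closed)
    then show ?case using u by (simp add: first_order_def central_l)
  next
    case (diff x y)
    have "act (x - y) u \<ominus>\<^bsub>M\<^esub> l (mu (x - y)) u
        = (act x u \<ominus>\<^bsub>M\<^esub> l (mu x) u) \<ominus>\<^bsub>M\<^esub> (act y u \<ominus>\<^bsub>M\<^esub> l (mu y) u)"
      using diff(1,2)
      by (simp add: act_diff mu_diff l_minus_scal mu_closed)
        (simp add: a_minus_def M.minus_add M.a_ac act_closed l_closed mu_closed)
    then show ?case using diff central_minus by simp
  qed
qed

text \<open>In a product of two elements of the diagonal ideal, the right factor sends
  \<open>u\<close> to a central element, which the left factor kills. Membership in
  \<open>formal_sums A\<close> is carried along because \<open>act_add\<close> needs it in the case
  of sums.\<close>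

lemma act_sq_ideal:
  assumes "t \<in> sq_ideal" and u: "first_order u"
  shows "t \<subseteq> formal_sums A \<and> (\<forall>w\<in>t. act w u = \<zero>\<^bsub>M\<^esub>)"
  using assms(1) unfolding sq_ideal_def
proof (induction rule: ideal_prod.induct)
  case (prod i j)
  have u': "u \<in> carrier M" using u by (simp add: first_order_def)
  obtain v0 where v0: "v0 \<in> formal_sums A" "mu v0 = \<zero>\<^bsub>A\<^esub>" "i = tclass v0"
    using prod by (auto simp: diag_ideal_eq)
  obtain w0 where w0: "w0 \<in> formal_sums A" "mu w0 = \<zero>\<^bsub>A\<^esub>" "j = tclass w0"
    using prod by (auto simp: diag_ideal_eq)
  have *: "x \<in> formal_sums A \<and> act x u = \<zero>\<^bsub>M\<^esub>" if "v \<in> i" "w \<in> j" "x \<in> tclass (pmult v w)" for v w x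
  proof -
    have v: "v \<in> formal_sums A" "mu v = \<zero>\<^bsub>A\<^esub>" and w: "w \<in> formal_sums A" "mu w = \<zero>\<^bsub>A\<^esub>"
      using mu_tclass[OF v0(1), of v] mu_tclass[OF w0(1), of w] tclass_closed[OF v0(1)]
        tclass_closed[OF w0(1)] that(1,2) by (auto simp: v0(2,3) w0(2,3))
    have vw: "pmult v w \<in> formal_sums A" using v w by (simp only: pmult_closed)
    \<comment> \<open>Since \<open>mu w\<close> is zero, the term subtracted in
      \<open>act_first_order\<close> vanishes.\<close>
    have "central (act w u)"
      using act_first_order[OF w(1) u] act_closed[OF w(1) u'] u' M.minus_plus[of "act w u" "\<zero>\<^bsub>M\<^esub>"]
      by (simp add: w(2) l_zero_scal)
    then have "act (pmult v w) u = \<zero>\<^bsub>M\<^esub>"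
      using act_central[OF v(1)] act_closed[OF w(1) u'] act_pmult[OF v(1) w(1) u']
      by (simp add: v(2) l_zero_scal)
    then show ?thesis
      using act_tclass[OF vw that(3) u'] tclass_closed[OF vw] that(3) by auto
  qed
  then show ?case by (auto simp only: mult_tensor_sq)
next
  case (sum s t)
  have u': "u \<in> carrier M" using u by (simp add: first_order_def)
  have "x + y \<in> formal_sums A \<and> act (x + y) u = \<zero>\<^bsub>M\<^esub>" if "x \<in> s" "y \<in> t" for x y
  proof -
    have "x \<in> formal_sums A" "y \<in> formal_sums A" "act x u = \<zero>\<^bsub>M\<^esub>" "act y u = \<zero>\<^bsub>M\<^esub>"
      using that sum.IH by blast+
    then show ?thesis using u' formal_sums_add[of x A y] by (simp only: act_add M.l_zero M.zero_closed)
  qed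
  then show ?case unfolding add_tensor_sq by blast
qed

text \<open>All representatives in the class act on \<open>u\<close> as \<open>w\<close> does, and
  \<open>w\<close> is one of them. The set from which \<open>the_elem\<close> takes its value is
  thus a singleton.\<close>

lemma parts_smult_pclass:
  assumes w: "w \<in> formal_sums A" and u: "first_order u"
  shows "parts_smult M l r (pclass w) u = act w u"
proof -
  have u': "u \<in> carrier M" using u by (simp add: first_order_def)
  have "act x u = act w u" if x: "x \<in> \<Union>(pclass w)" for x
  proof -
    obtain t y z where t: "t \<in> sq_ideal" "y \<in> t" "z \<in> tclass w" "x = y + z"
      using x by (auto simp: pclass_def)
    have y: "y \<in> formal_sums A" "act y u = \<zero>\<^bsub>M\<^esub>" using act_sq_ideal[OF t(1) u] t(2) by blast+
    have z: "z \<in> formal_sums A" "act z u = act w u"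
      using act_tclass[OF w t(3) u'] tclass_closed[OF w] t(3) by blast+
    show ?thesis using y z u' w by (simp only: t act_add M.l_zero act_closed)
  qed
  then have "(\<lambda>x. act x u) ` \<Union>(pclass w) = {act w u}"
    using self_pclass by blast
  then show ?thesis by (simp add: parts_smult_def act_def)
qed

end

text \<open>Additivity reduces the claim to generators \<open>(a, b)\<close>, where the hypotheses
  move \<open>h\<close> past the left action and then past the right action. This passes from
  compatibility with two actions of \<open>A\<close> to linearity over formal sums.\<close>

lemma (in tensor_square) act_natural:
  assumes "bimodule k A M l r" "bimodule k A N l' r'"
    and h: "h \<in> carrier M \<rightarrow> carrier N"
    and h_add: "\<And>u v. u \<in> carrier M \<Longrightarrow> v \<in> carrier M \<Longrightarrow> h (u \<oplus>\<^bsub>M\<^esub> v) = h u \<oplus>\<^bsub>N\<^esub> h v"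
    and h_l: "\<And>a u. a \<in> carrier A \<Longrightarrow> u \<in> carrier M \<Longrightarrow> h (l a u) = l' a (h u)"
    and h_r: "\<And>a u. a \<in> carrier A \<Longrightarrow> u \<in> carrier M \<Longrightarrow> h (r u a) = r' (h u) a"
    and w: "w \<in> formal_sums A" and u: "u \<in> carrier M"
  shows "h (bimodule.act M l r w u) = bimodule.act N l' r' w (h u)"
proof -
  interpret M: bimodule k A M l r by (rule assms(1))
  interpret N: bimodule k A N l' r' by (rule assms(2))
  have [simp]: "h v \<in> carrier N" if "v \<in> carrier M" for v
    by (rule funcset_mem[OF h that])
  have h_minus: "h (x \<ominus>\<^bsub>M\<^esub> y) = h x \<ominus>\<^bsub>N\<^esub> h y" if "x \<in> carrier M" "y \<in> carrier M" for x y
    using h_add[of "x \<ominus>\<^bsub>M\<^esub> y" y] that by (simp add: M.M.minus_plus N.M.plus_minus)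
  have h_zero: "h \<zero>\<^bsub>M\<^esub> = \<zero>\<^bsub>N\<^esub>"
    using h_l[of "\<zero>\<^bsub>A\<^esub>" "\<zero>\<^bsub>M\<^esub>"] by (simp add: M.l_zero_scal N.l_zero_scal)
  from w have "Poly_Mapping.keys w \<subseteq> carrier A \<times> carrier A" by simp
  then show ?thesis
  proof (induction w rule: frag_span_induct)
    case (one p)
    then show ?case
      using u by (cases p) (simp add: M.act_of N.act_of h_l h_r M.r_closed)
  next
    case (diff v w)
    then show ?case
      using u by (simp add: M.act_diff N.act_diff h_minus M.act_closed)
  qed (simp add: M.act_0 N.act_0 h_zero)
qed

section \<open>Differential operators and the extension\<close>

locale operators = tensor_square k A + E: module A E
  for k :: "('k, 'z) ring_scheme" and A :: "('k, 'a, 'q) module_scheme"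
    and E :: "('a, 'e) module"
begin

abbreviation left_mult :: "'a \<Rightarrow> ('e \<Rightarrow> 'e) \<Rightarrow> 'e \<Rightarrow> 'e" where
  "left_mult a \<delta> \<equiv> \<lambda>e\<in>carrier E. a \<odot>\<^bsub>E\<^esub> \<delta> e"

abbreviation right_mult :: "('e \<Rightarrow> 'e) \<Rightarrow> 'a \<Rightarrow> 'e \<Rightarrow> 'e" where
  "right_mult \<delta> b \<equiv> \<lambda>e\<in>carrier E. \<delta> (b \<odot>\<^bsub>E\<^esub> e)"

lemma End_kI:
  assumes "s \<in> carrier E \<rightarrow>\<^sub>E carrier E"
    and "\<And>e e'. e \<in> carrier E \<Longrightarrow> e' \<in> carrier E \<Longrightarrow> s (e \<oplus>\<^bsub>E\<^esub> e') = s e \<oplus>\<^bsub>E\<^esub> s e'"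
    and "\<And>c e. c \<in> carrier k \<Longrightarrow> e \<in> carrier E
      \<Longrightarrow> s (struct_map A c \<odot>\<^bsub>E\<^esub> e) = struct_map A c \<odot>\<^bsub>E\<^esub> s e"
  shows "s \<in> carrier (End_k k A E)"
  using assms by (simp add: End_k_def)

lemma End_kD:
  assumes "s \<in> carrier (End_k k A E)"
  shows "s \<in> carrier E \<rightarrow>\<^sub>E carrier E"
    and "e \<in> carrier E \<Longrightarrow> s e \<in> carrier E"
    and "e \<in> carrier E \<Longrightarrow> e' \<in> carrier E \<Longrightarrow> s (e \<oplus>\<^bsub>E\<^esub> e') = s e \<oplus>\<^bsub>E\<^esub> s e'"
    and "c \<in> carrier k \<Longrightarrow> e \<in> carrier E
      \<Longrightarrow> s (struct_map A c \<odot>\<^bsub>E\<^esub> e) = struct_map A c \<odot>\<^bsub>E\<^esub> s e"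
  using assms by (auto simp: End_k_def)

lemma End_k_add: "s \<oplus>\<^bsub>End_k k A E\<^esub> t = op_add E s t"
  and End_k_zero: "\<zero>\<^bsub>End_k k A E\<^esub> = op_zero E"
  and End_k_smult: "a \<odot>\<^bsub>End_k k A E\<^esub> s = left_mult a s"
  by (simp_all add: End_k_def)

lemma End_k_ext:
  assumes "s \<in> carrier (End_k k A E)" "t \<in> carrier (End_k k A E)"
    and "\<And>e. e \<in> carrier E \<Longrightarrow> s e = t e"
  shows "s = t"
  using End_kD(1)[OF assms(1)] End_kD(1)[OF assms(2)] assms(3) by (rule PiE_ext)

lemma scal_comm:
  assumes "a \<in> carrier A" "b \<in> carrier A" "e \<in> carrier E"
  shows "a \<odot>\<^bsub>E\<^esub> (b \<odot>\<^bsub>E\<^esub> e) = b \<odot>\<^bsub>E\<^esub> (a \<odot>\<^bsub>E\<^esub> e)"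
  using assms by (simp flip: E.smult_assoc1) (simp add: A.m_comm)

lemma op_add_closed:
  assumes s: "s \<in> carrier (End_k k A E)" and t: "t \<in> carrier (End_k k A E)"
  shows "op_add E s t \<in> carrier (End_k k A E)"
proof (rule End_kI)
  show "op_add E s t \<in> carrier E \<rightarrow>\<^sub>E carrier E"
    using s t by (auto simp: op_add_def End_kD)
  show "op_add E s t (e \<oplus>\<^bsub>E\<^esub> e') = op_add E s t e \<oplus>\<^bsub>E\<^esub> op_add E s t e'"
    if "e \<in> carrier E" "e' \<in> carrier E" for e e'
    using that by (simp add: op_add_def End_kD(2,3)[OF s] End_kD(2,3)[OF t] E.M.a_ac)
  show "op_add E s t (struct_map A c \<odot>\<^bsub>E\<^esub> e) = struct_map A c \<odot>\<^bsub>E\<^esub> op_add E s t e"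
    if "c \<in> carrier k" "e \<in> carrier E" for c e
    using that by (simp add: op_add_def End_kD(2,4)[OF s] End_kD(2,4)[OF t] struct_map_closed E.smult_r_distr)
qed

lemma left_mult_closed:
  assumes "a \<in> carrier A" and s: "s \<in> carrier (End_k k A E)"
  shows "left_mult a s \<in> carrier (End_k k A E)"
proof (rule End_kI)
  show "left_mult a s \<in> carrier E \<rightarrow>\<^sub>E carrier E"
    using assms by (auto simp: End_kD)
  show "left_mult a s (e \<oplus>\<^bsub>E\<^esub> e') = left_mult a s e \<oplus>\<^bsub>E\<^esub> left_mult a s e'"
    if "e \<in> carrier E" "e' \<in> carrier E" for e e'
    using that assms(1) by (simp add: End_kD(2,3)[OF s] E.smult_r_distr)
  show "left_mult a s (struct_map A c \<odot>\<^bsub>E\<^esub> e) = struct_map A c \<odot>\<^bsub>E\<^esub> left_mult a s e"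
    if "c \<in> carrier k" "e \<in> carrier E" for c e
    using that assms(1) scal_comm[of a "struct_map A c" "s e"]
    by (simp add: End_kD(2,4)[OF s] struct_map_closed)
qed

lemma right_mult_closed:
  assumes "a \<in> carrier A" and s: "s \<in> carrier (End_k k A E)"
  shows "right_mult s a \<in> carrier (End_k k A E)"
proof (rule End_kI)
  show "right_mult s a \<in> carrier E \<rightarrow>\<^sub>E carrier E"
    using assms by (auto simp: End_kD)
  show "right_mult s a (e \<oplus>\<^bsub>E\<^esub> e') = right_mult s a e \<oplus>\<^bsub>E\<^esub> right_mult s a e'"
    if "e \<in> carrier E" "e' \<in> carrier E" for e e'
    using that assms(1) by (simp add: End_kD(2,3)[OF s] E.smult_r_distr)
  show "right_mult s a (struct_map A c \<odot>\<^bsub>E\<^esub> e) = struct_map A c \<odot>\<^bsub>E\<^esub> right_mult s a e"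
    if "c \<in> carrier k" "e \<in> carrier E" for c e
    using that assms(1) scal_comm[of a "struct_map A c" e]
    by (simp add: End_kD(2,4)[OF s] struct_map_closed)
qed

lemma op_zero_closed: "op_zero E \<in> carrier (End_k k A E)"
  by (rule End_kI) (auto simp: op_zero_def struct_map_closed)

lemma abelian_group_End_k: "abelian_group (End_k k A E)"
proof (rule abelian_groupI)
  fix s assume s: "s \<in> carrier (End_k k A E)"
  \<comment> \<open>Multiplication by minus one serves as the additive inverse, since
    \<open>left_mult_closed\<close> already places it in \<open>End_k\<close>.\<close>
  have "left_mult (\<ominus>\<^bsub>A\<^esub> \<one>\<^bsub>A\<^esub>) s \<oplus>\<^bsub>End_k k A E\<^esub> s = \<zero>\<^bsub>End_k k A E\<^esub>"
    using s by (auto simp: End_k_add End_k_zero op_add_def op_zero_def End_kD E.smult_l_minus E.M.l_neg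
        intro!: restrict_ext)
  then show "\<exists>t\<in>carrier (End_k k A E). t \<oplus>\<^bsub>End_k k A E\<^esub> s = \<zero>\<^bsub>End_k k A E\<^esub>"
    using s left_mult_closed by blast
  show "\<zero>\<^bsub>End_k k A E\<^esub> \<oplus>\<^bsub>End_k k A E\<^esub> s = s"
    unfolding End_k_add End_k_zero
    by (rule End_k_ext[OF op_add_closed[OF op_zero_closed s] s])
      (simp add: op_add_def op_zero_def End_kD(2)[OF s])
  show "s \<oplus>\<^bsub>End_k k A E\<^esub> t \<in> carrier (End_k k A E)" if "t \<in> carrier (End_k k A E)" for t
    unfolding End_k_add using s that by (rule op_add_closed)
qed (auto simp: End_k_add End_k_zero op_zero_closed op_add_def End_kD E.M.a_ac
      intro!: restrict_ext)

text \<open>The left action multiplies after the operator and the right action before it, so the two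
  commute; \<open>balanced\<close> is exactly the \<open>k\<close>-linearity of the
  operators.\<close>

lemma bimodule_End_k: "bimodule k A (End_k k A E) left_mult right_mult"
proof (intro bimodule.intro tensor_square_axioms abelian_group_End_k bimodule_axioms.intro)
  fix s assume "s \<in> carrier (End_k k A E)"
  then show "left_mult \<one>\<^bsub>A\<^esub> s = s" "right_mult s \<one>\<^bsub>A\<^esub> = s"
    by (auto intro!: End_k_ext left_mult_closed right_mult_closed simp: End_kD)
qed (auto simp: left_mult_closed right_mult_closed End_k_add op_add_def End_kD E.smult_r_distr
    E.smult_l_distr E.smult_assoc1 A.m_comm[of _ _] struct_map_closed scal_comm intro!: restrict_ext)

sublocale End: bimodule k A "End_k k A E" left_mult right_mult
  by (rule bimodule_End_k)

text \<open>The difference in \<open>End_k\<close> is formed with the abstract inverse of the group,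
  so its values are obtained from \<open>(s - t) + t = s\<close>.\<close>

lemma End_k_minus_apply:
  assumes s: "s \<in> carrier (End_k k A E)" and t: "t \<in> carrier (End_k k A E)" and e: "e \<in> carrier E"
  shows "(s \<ominus>\<^bsub>End_k k A E\<^esub> t) e = s e \<ominus>\<^bsub>E\<^esub> t e"
proof -
  let ?d = "s \<ominus>\<^bsub>End_k k A E\<^esub> t"
  have d: "?d \<in> carrier (End_k k A E)" using s t by (rule End.M.minus_closed)
  have "s e = (?d \<oplus>\<^bsub>End_k k A E\<^esub> t) e" using s t by (simp add: End.M.minus_plus)
  also have "\<dots> = ?d e \<oplus>\<^bsub>E\<^esub> t e" using e by (simp add: End_k_add op_add_def)
  finally show ?thesis
    using End_kD(2)[OF d e] End_kD(2)[OF t e] by (simp add: a_minus_def E.M.a_assoc E.M.r_neg)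
qed

text \<open>Commutators with multiplications are the elements \<open>ub - bu\<close> of the
  bimodule. This connects the definition of \<open>Diff1\<close> with
  \<open>first_order\<close>.\<close>

lemma commutator_mult_op:
  assumes s: "s \<in> carrier (End_k k A E)" and b: "b \<in> carrier A"
  shows "commutator E s (mult_op E b) = right_mult s b \<ominus>\<^bsub>End_k k A E\<^esub> left_mult b s"
proof -
  let ?d = "right_mult s b \<ominus>\<^bsub>End_k k A E\<^esub> left_mult b s"
  have d: "?d \<in> carrier (End_k k A E)"
    using assms by (intro End.M.minus_closed left_mult_closed right_mult_closed)
  have "commutator E s (mult_op E b) e = ?d e" if e: "e \<in> carrier E" for e
    using e b by (simp add: End_k_minus_apply left_mult_closed right_mult_closed s commutator_def
        mult_op_def End_kD(2)[OF s])
  moreover have "commutator E s (mult_op E b) \<in> extensional (carrier E)"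
    by (simp add: commutator_def)
  ultimately show ?thesis
    using End_kD(1)[OF d] by (intro extensionalityI[of _ "carrier E"]) (auto simp: PiE_def)
qed

text \<open>The inner commutator with \<open>a\<close> is \<open>\<delta>a - a\<delta>\<close>, and
  all its commutators with multiplications vanish precisely when it is central. For an operator
  outside \<open>End_k\<close> both sides are false.\<close>

lemma Diff1_iff: "\<delta> \<in> carrier (Diff1 k A E) \<longleftrightarrow> End.first_order \<delta>"
proof (cases "\<delta> \<in> carrier (End_k k A E)")
  case True
  have "commutator E (commutator E \<delta> (mult_op E a)) (mult_op E b) = op_zero E
      \<longleftrightarrow> right_mult (commutator E \<delta> (mult_op E a)) b = left_mult b (commutator E \<delta> (mult_op E a))"
    if a: "a \<in> carrier A" and b: "b \<in> carrier A" for a b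
  proof -
    let ?c = "commutator E \<delta> (mult_op E a)"
    have c: "?c \<in> carrier (End_k k A E)"
      using a True by (simp add: commutator_mult_op left_mult_closed right_mult_closed)
    show ?thesis
      using b c by (simp only: commutator_mult_op[OF c b] End_k_zero[symmetric]
          End.M.minus_eq_zero_iff left_mult_closed right_mult_closed)
  qed
  moreover have "commutator E \<delta> (mult_op E a) \<in> carrier (End_k k A E)" if "a \<in> carrier A" for a
    using that True by (simp add: commutator_mult_op left_mult_closed right_mult_closed)
  ultimately show ?thesis
    using True
    by (simp add: Diff1_def End.first_order_def End.central_def flip: commutator_mult_op)
next
  case False
  then show ?thesis by (simp add: Diff1_def End.first_order_def)
qed

lemma Diff1_add: "s \<oplus>\<^bsub>Diff1 k A E\<^esub> t = s \<oplus>\<^bsub>End_k k A E\<^esub> t"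
  by (simp add: Diff1_def End_k_add)

lemma Diff1_smult:
  assumes "w \<in> formal_sums A" "\<delta> \<in> carrier (Diff1 k A E)"
  shows "pclass w \<odot>\<^bsub>Diff1 k A E\<^esub> \<delta> = End.act w \<delta>"
  using End.parts_smult_pclass[OF assms(1)] assms(2) by (simp add: Diff1_iff) (simp add: Diff1_def)

end

section \<open>The extension of \<open>L\<close> as a bimodule\<close>

locale lie_rinehart_algebra =
  fixes k :: "('k, 'z) ring_scheme" and A :: "('k, 'a) module"
    and L :: "('a, 'l) lie_module" and \<alpha> :: "'l \<Rightarrow> 'a \<Rightarrow> 'a"
  assumes is_lie_rinehart: "lie_rinehart k A L \<alpha>"
begin

sublocale tensor_square k A
  using is_lie_rinehart by (intro tensor_square.intro) (simp add: lie_rinehart_def)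

sublocale L: module A L
  using is_lie_rinehart by (simp add: lie_rinehart_def)

lemma lbr_closed: "x \<in> carrier L \<Longrightarrow> y \<in> carrier L \<Longrightarrow> lbr L x y \<in> carrier L"
  using is_lie_rinehart lie_algebra.lbr_closed[of k "restrict_scalars A L" x y]
  by (simp add: lie_rinehart_def restrict_scalars_def)

lemma anchor: "\<alpha> \<in> lin_maps A L (Der k A)"
  using is_lie_rinehart by (simp add: lie_rinehart_def)

lemma anchor_Der: "x \<in> carrier L \<Longrightarrow> \<alpha> x \<in> carrier (Der k A)"
  using anchor by (auto simp: lin_maps_def)

lemma anchor_closed: "x \<in> carrier L \<Longrightarrow> a \<in> carrier A \<Longrightarrow> \<alpha> x a \<in> carrier A"
  using anchor_Der[of x] by (auto simp: Der_def)

lemma anchor_derivation: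
  assumes "x \<in> carrier L"
  shows "\<lbrakk>a \<in> carrier A; b \<in> carrier A\<rbrakk> \<Longrightarrow> \<alpha> x (a \<oplus>\<^bsub>A\<^esub> b) = \<alpha> x a \<oplus>\<^bsub>A\<^esub> \<alpha> x b"
    and "\<lbrakk>a \<in> carrier A; b \<in> carrier A\<rbrakk> \<Longrightarrow> \<alpha> x (a \<otimes>\<^bsub>A\<^esub> b) = a \<otimes>\<^bsub>A\<^esub> \<alpha> x b \<oplus>\<^bsub>A\<^esub> \<alpha> x a \<otimes>\<^bsub>A\<^esub> b"
    and "\<lbrakk>c \<in> carrier k; a \<in> carrier A\<rbrakk> \<Longrightarrow> \<alpha> x (c \<odot>\<^bsub>A\<^esub> a) = c \<odot>\<^bsub>A\<^esub> \<alpha> x a"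
  using anchor_Der[OF assms] by (auto simp: Der_def)

lemma anchor_linear:
  "\<lbrakk>x \<in> carrier L; y \<in> carrier L; a \<in> carrier A\<rbrakk> \<Longrightarrow> \<alpha> (x \<oplus>\<^bsub>L\<^esub> y) a = \<alpha> x a \<oplus>\<^bsub>A\<^esub> \<alpha> y a"
  "\<lbrakk>b \<in> carrier A; x \<in> carrier L; a \<in> carrier A\<rbrakk> \<Longrightarrow> \<alpha> (b \<odot>\<^bsub>L\<^esub> x) a = b \<otimes>\<^bsub>A\<^esub> \<alpha> x a"
  using anchor by (simp_all add: lin_maps_def Der_def op_add_def)

lemma anchor_zero: "a \<in> carrier A \<Longrightarrow> \<alpha> \<zero>\<^bsub>L\<^esub> a = \<zero>\<^bsub>A\<^esub>"
  using anchor_linear(2)[of "\<zero>\<^bsub>A\<^esub>" "\<zero>\<^bsub>L\<^esub>" a] by (simp add: anchor_closed)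

lemma anchor_one: "x \<in> carrier L \<Longrightarrow> \<alpha> x \<one>\<^bsub>A\<^esub> = \<zero>\<^bsub>A\<^esub>"
  using anchor_derivation(2)[of x "\<one>\<^bsub>A\<^esub>" "\<one>\<^bsub>A\<^esub>"] anchor_closed[of x "\<one>\<^bsub>A\<^esub>"]
  by (simp add: A.add.l_cancel_one')

text \<open>A \<open>k\<close>-linear derivation kills the unit and hence the image of
  \<open>k\<close>. The derivative term in the right action therefore disappears for scalars of
  \<open>k\<close>, as \<open>balanced\<close> demands.\<close>

lemma anchor_struct_map: "x \<in> carrier L \<Longrightarrow> c \<in> carrier k \<Longrightarrow> \<alpha> x (struct_map A c) = \<zero>\<^bsub>A\<^esub>"
  using anchor_derivation(3)[of x c "\<one>\<^bsub>A\<^esub>"]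
  by (simp add: struct_map_def[of A c] anchor_one) (simp add: scal_eq struct_map_closed)

abbreviation X :: "('a \<times> 'l) ring" where "X \<equiv> ext_group A L"

lemma ext_group_simps:
  "carrier X = carrier A \<times> carrier L" "\<zero>\<^bsub>X\<^esub> = (\<zero>\<^bsub>A\<^esub>, \<zero>\<^bsub>L\<^esub>)"
  "(a, x) \<oplus>\<^bsub>X\<^esub> (b, y) = (a \<oplus>\<^bsub>A\<^esub> b, x \<oplus>\<^bsub>L\<^esub> y)"
  by (simp_all add: ext_group_def)

lemma ext_left_apply: "ext_left A L c (a, x) = (c \<otimes>\<^bsub>A\<^esub> a, c \<odot>\<^bsub>L\<^esub> x)"
  and ext_right_apply: "ext_right A L \<alpha> (a, x) c = (a \<otimes>\<^bsub>A\<^esub> c \<oplus>\<^bsub>A\<^esub> \<alpha> x c, c \<odot>\<^bsub>L\<^esub> x)"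
  by (simp_all add: ext_left_def ext_right_def)

lemma abelian_group_ext: "abelian_group X"
proof (rule abelian_groupI)
  fix u assume "u \<in> carrier X"
  then show "\<exists>v\<in>carrier X. v \<oplus>\<^bsub>X\<^esub> u = \<zero>\<^bsub>X\<^esub>"
    by (intro bexI[of _ "(\<ominus>\<^bsub>A\<^esub> fst u, \<ominus>\<^bsub>L\<^esub> snd u)"]) (auto simp: ext_group_simps A.l_neg L.M.l_neg)
qed (auto simp: ext_group_simps A.a_assoc L.M.a_assoc intro: A.a_comm L.M.a_comm)

text \<open>The identity \<open>u(ab) = (ua)b\<close> is the Leibniz rule of the anchor. The unit
  law and \<open>balanced\<close> for the right action hold because the anchor kills the unit and
  the image of \<open>k\<close>.\<close>

lemma bimodule_ext: "bimodule k A X (ext_left A L) (ext_right A L \<alpha>)"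
proof (intro bimodule.intro tensor_square_axioms abelian_group_ext bimodule_axioms.intro)
  fix a b u assume ab: "a \<in> carrier A" "b \<in> carrier A" and "u \<in> carrier X"
  then obtain c x where u: "u = (c, x)" "c \<in> carrier A" "x \<in> carrier L"
    by (auto simp: ext_group_simps)
  \<comment> \<open>The second bracket on the left is the Leibniz expansion of
    \<open>\<alpha> x\<close> at the product of \<open>a\<close> and \<open>b\<close>.\<close>
  have "c \<otimes>\<^bsub>A\<^esub> (a \<otimes>\<^bsub>A\<^esub> b) \<oplus>\<^bsub>A\<^esub> (a \<otimes>\<^bsub>A\<^esub> \<alpha> x b \<oplus>\<^bsub>A\<^esub> \<alpha> x a \<otimes>\<^bsub>A\<^esub> b)
      = (c \<otimes>\<^bsub>A\<^esub> a \<oplus>\<^bsub>A\<^esub> \<alpha> x a) \<otimes>\<^bsub>A\<^esub> b \<oplus>\<^bsub>A\<^esub> a \<otimes>\<^bsub>A\<^esub> \<alpha> x b"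
    using ab u by (simp add: anchor_closed A.l_distr A.m_assoc A.a_ac)
  moreover have "(a \<otimes>\<^bsub>A\<^esub> b) \<odot>\<^bsub>L\<^esub> x = b \<odot>\<^bsub>L\<^esub> (a \<odot>\<^bsub>L\<^esub> x)"
    using ab u by (simp add: A.m_comm[of a b] L.smult_assoc1)
  ultimately show "ext_right A L \<alpha> u (a \<otimes>\<^bsub>A\<^esub> b) = ext_right A L \<alpha> (ext_right A L \<alpha> u a) b"
    using ab u by (simp add: ext_right_apply anchor_derivation anchor_linear)
next
  fix a b u assume "a \<in> carrier A" "b \<in> carrier A" "u \<in> carrier X"
  then show "ext_right A L \<alpha> (ext_left A L a u) b = ext_left A L a (ext_right A L \<alpha> u b)"
    by (cases u) (simp add: ext_group_simps ext_right_apply ext_left_apply anchor_closed anchor_linear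
        A.r_distr A.m_assoc flip: L.smult_assoc1, simp add: A.m_comm)
next
  fix c u assume "c \<in> carrier k" "u \<in> carrier X"
  then show "ext_left A L (struct_map A c) u = ext_right A L \<alpha> u (struct_map A c)"
    by (cases u) (simp add: ext_group_simps ext_right_apply ext_left_apply anchor_struct_map
        struct_map_closed A.m_comm)
qed (auto simp: ext_group_simps ext_right_apply ext_left_apply anchor_closed anchor_linear
    anchor_derivation anchor_one A.l_distr A.r_distr A.m_assoc A.a_ac L.smult_r_distr L.smult_l_distr
    L.smult_assoc1)

sublocale Ext: bimodule k A X "ext_left A L" "ext_right A L \<alpha>"
  by (rule bimodule_ext)

text \<open>For \<open>u = az + x\<close> the difference \<open>ub - bu\<close> is
  \<open>\<alpha>(x)(b)z\<close>. Multiples of \<open>z\<close> are central, because the anchor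
  vanishes at the zero of \<open>L\<close>.\<close>

lemma first_order_ext:
  assumes u: "u \<in> carrier X"
  shows "Ext.first_order u"
proof -
  obtain a x where [simp]: "u = (a, x)" "a \<in> carrier A" "x \<in> carrier L"
    using u by (auto simp: ext_group_simps)
  have "Ext.central (ext_right A L \<alpha> u b \<ominus>\<^bsub>X\<^esub> ext_left A L b u)" if [simp]: "b \<in> carrier A" for b
  proof -
    have "ext_right A L \<alpha> u b = (\<alpha> x b, \<zero>\<^bsub>L\<^esub>) \<oplus>\<^bsub>X\<^esub> ext_left A L b u"
      by (simp add: ext_group_simps ext_left_apply ext_right_apply anchor_closed A.m_comm[of a b] A.a_comm)
    then have "ext_right A L \<alpha> u b \<ominus>\<^bsub>X\<^esub> ext_left A L b u = (\<alpha> x b, \<zero>\<^bsub>L\<^esub>)"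
      using Ext.M.plus_minus[of "(\<alpha> x b, \<zero>\<^bsub>L\<^esub>)" "ext_left A L b u"] Ext.l_closed[OF that u]
      by (simp add: ext_group_simps(1) anchor_closed)
    then show ?thesis
      by (simp add: Ext.central_def ext_group_simps ext_left_apply ext_right_apply anchor_closed
          anchor_zero A.m_comm)
  qed
  then show ?thesis using u unfolding Ext.first_order_def by blast
qed

lemma lr_ext_simps:
  "carrier (lr_ext A L \<alpha> g) = carrier X"
  "u \<oplus>\<^bsub>lr_ext A L \<alpha> g\<^esub> v = u \<oplus>\<^bsub>X\<^esub> v"
  "lbr (lr_ext A L \<alpha> g) (a, x) (b, y) = (\<alpha> x b \<ominus>\<^bsub>A\<^esub> \<alpha> y a \<oplus>\<^bsub>A\<^esub> g x y, lbr L x y)"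
  by (simp_all add: lr_ext_def)

lemma lr_ext_smult:
  assumes "w \<in> formal_sums A" "u \<in> carrier X"
  shows "pclass w \<odot>\<^bsub>lr_ext A L \<alpha> g\<^esub> u = Ext.act w u"
  using Ext.parts_smult_pclass[OF assms(1) first_order_ext[OF assms(2)]] by (simp add: lr_ext_def)

end

section \<open>Connections\<close>

lemma natural_iso_identity:
  assumes "category C" "cat_functor C C Fo Fm"
    and "\<And>X. X \<in> obj C \<Longrightarrow> Fo X = X"
    and "\<And>X Y f. X \<in> obj C \<Longrightarrow> Y \<in> obj C \<Longrightarrow> f \<in> hom_set C X Y \<Longrightarrow> Fm X Y f = f"
  shows "natural_iso C C (\<lambda>X. X) (\<lambda>X Y f. f) Fo Fm (cat_id C)"
    and "natural_iso C C Fo Fm (\<lambda>X. X) (\<lambda>X Y f. f) (cat_id C)"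
proof -
  interpret C: category C by fact
  have iso: "is_iso_in C X X (cat_id C X)" if "X \<in> obj C" for X
    using that C.ident_closed C.comp_ident_left unfolding is_iso_in_def by blast
  show "natural_iso C C (\<lambda>X. X) (\<lambda>X Y f. f) Fo Fm (cat_id C)"
    by unfold_locales (simp_all add: assms(3,4) iso C.comp_ident_left C.comp_ident_right)
  show "natural_iso C C Fo Fm (\<lambda>X. X) (\<lambda>X Y f. f) (cat_id C)"
    by unfold_locales (simp_all add: assms(3,4) iso C.comp_ident_left C.comp_ident_right)
qed

text \<open>The two functors are inverse to each other on objects and morphisms, so identity
  morphisms serve as the components of both natural isomorphisms. Agreement of the composites with
  the identity is asked only inside the categories, since the underlying functions may differ
  elsewhere.\<close>

lemma equivalence_of_categoriesI:
  assumes "category C" "category D" "cat_functor C D Fo Fm" "cat_functor D C Go Gm"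
    and "\<And>X. X \<in> obj C \<Longrightarrow> Go (Fo X) = X"
    and "\<And>X Y f. X \<in> obj C \<Longrightarrow> Y \<in> obj C \<Longrightarrow> f \<in> hom_set C X Y \<Longrightarrow> Gm (Fo X) (Fo Y) (Fm X Y f) = f"
    and "\<And>X. X \<in> obj D \<Longrightarrow> Fo (Go X) = X"
    and "\<And>X Y f. X \<in> obj D \<Longrightarrow> Y \<in> obj D \<Longrightarrow> f \<in> hom_set D X Y \<Longrightarrow> Fm (Go X) (Go Y) (Gm X Y f) = f"
  shows "equivalence_of_categories C D Fo Fm"
proof -
  interpret C: category C by fact
  interpret D: category D by fact
  interpret F: cat_functor C D Fo Fm by fact
  interpret G: cat_functor D C Go Gm by fact
  have "cat_functor C C (\<lambda>X. Go (Fo X)) (\<lambda>X Y f. Gm (Fo X) (Fo Y) (Fm X Y f))"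
    by unfold_locales
      (simp_all add: F.obj_closed F.hom_closed F.pres_ident F.pres_comp
        G.obj_closed G.hom_closed G.pres_ident G.pres_comp)
  moreover have "cat_functor D D (\<lambda>X. Fo (Go X)) (\<lambda>X Y f. Fm (Go X) (Go Y) (Gm X Y f))"
    by unfold_locales
      (simp_all add: F.obj_closed F.hom_closed F.pres_ident F.pres_comp
        G.obj_closed G.hom_closed G.pres_ident G.pres_comp)
  ultimately show ?thesis
    unfolding equivalence_of_categories_def
    using assms natural_iso_identity[of C "\<lambda>X. Go (Fo X)" "\<lambda>X Y f. Gm (Fo X) (Fo Y) (Fm X Y f)"]
      natural_iso_identity[of D "\<lambda>X. Fo (Go X)" "\<lambda>X Y f. Fm (Go X) (Go Y) (Gm X Y f)"]
    by blast
qed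

section \<open>Linear maps and the two categories of connections\<close>

lemma id_on_lin_maps:
  assumes "module A E"
  shows "id_on E \<in> lin_maps A E E \<inter> extensional (carrier E)"
proof -
  interpret module A E by fact
  show ?thesis by (auto simp: lin_maps_def id_on_def)
qed

lemma compose_lin_maps:
  assumes "module A E" "f \<in> lin_maps A E F" "g \<in> lin_maps A F G"
  shows "compose (carrier E) g f \<in> lin_maps A E G \<inter> extensional (carrier E)"
proof -
  interpret module A E by fact
  show ?thesis using assms(2,3) by (auto simp: lin_maps_def compose_def Pi_iff)
qed

lemma compose_id_on:
  assumes "f \<in> lin_maps A E F \<inter> extensional (carrier E)"
  shows "compose (carrier E) f (id_on E) = f" and "compose (carrier E) (id_on F) f = f"
  using assms by (auto simp: lin_maps_def compose_def id_on_def extensional_def Pi_iff fun_eq_iff)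

lemma compose_assoc_lin:
  assumes "f \<in> lin_maps A E F"
  shows "compose (carrier E) h (compose (carrier E) g f) = compose (carrier E) (compose (carrier F) h g) f"
  using assms by (auto simp: lin_maps_def compose_def Pi_iff fun_eq_iff)

lemma parts_connection_closed:
  assumes "parts_connection k A U E \<rho>" "u \<in> carrier U" "e \<in> carrier E"
  shows "\<rho> u e \<in> carrier E"
  using assms by (auto simp: parts_connection_def lin_maps_def Diff1_def End_k_def Pi_iff)

lemma psi_connection_closed:
  assumes "psi_connection k A L \<alpha> E \<psi> nab" "e \<in> carrier E"
  shows "\<psi> e \<in> carrier E" and "x \<in> carrier L \<Longrightarrow> nab x e \<in> carrier E"
  using assms by (auto simp: psi_connection_def lin_maps_def End_A_def End_k_def Pi_iff)

lemma category_Conn: "category (Conn k A U)"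
proof
  fix X assume "X \<in> obj (Conn k A U)"
  then obtain E \<rho> where X: "X = (E, \<rho>)" "module A E" "parts_connection k A U E \<rho>"
    by (auto simp: Conn_def)
  then show "cat_id (Conn k A U) X \<in> hom_set (Conn k A U) X X"
    using id_on_lin_maps[OF X(2)] parts_connection_closed[OF X(3)]
    by (auto simp: Conn_def id_on_def)
next
  fix X Y Z f g
  assume *: "X \<in> obj (Conn k A U)" "Y \<in> obj (Conn k A U)" "Z \<in> obj (Conn k A U)"
    "f \<in> hom_set (Conn k A U) X Y" "g \<in> hom_set (Conn k A U) Y Z"
  obtain E \<rho> F \<rho>' G \<rho>'' where X: "X = (E, \<rho>)" "Y = (F, \<rho>')" "Z = (G, \<rho>'')"
    by (metis surj_pair)
  have E: "module A E" "parts_connection k A U E \<rho>" using * by (auto simp: X Conn_def)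
  have f: "f \<in> lin_maps A E F" "\<And>u e. u \<in> carrier U \<Longrightarrow> e \<in> carrier E \<Longrightarrow> \<rho>' u (f e) = f (\<rho> u e)"
    using * by (auto simp: X Conn_def)
  have g: "g \<in> lin_maps A F G" "\<And>u e. u \<in> carrier U \<Longrightarrow> e \<in> carrier F \<Longrightarrow> \<rho>'' u (g e) = g (\<rho>' u e)"
    using * by (auto simp: X Conn_def)
  have "f e \<in> carrier F" if "e \<in> carrier E" for e using f(1) that by (auto simp: lin_maps_def)
  then show "cat_comp (Conn k A U) X Y Z g f \<in> hom_set (Conn k A U) X Z"
    using compose_lin_maps[OF E(1) f(1) g(1)] parts_connection_closed[OF E(2)] f(2) g(2)
    by (simp add: X Conn_def compose_def)
qed (auto simp: Conn_def compose_id_on compose_assoc_lin)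

lemma category_Conn_End: "category (Conn_End k A L \<alpha>)"
proof
  fix X assume "X \<in> obj (Conn_End k A L \<alpha>)"
  then obtain E \<psi> nab where X: "X = (E, \<psi>, nab)" "module A E" "psi_connection k A L \<alpha> E \<psi> nab"
    by (auto simp: Conn_End_def)
  then show "cat_id (Conn_End k A L \<alpha>) X \<in> hom_set (Conn_End k A L \<alpha>) X X"
    using id_on_lin_maps[OF X(2)] psi_connection_closed[OF X(3)]
    by (auto simp: Conn_End_def id_on_def)
next
  fix X Y Z f g
  assume *: "X \<in> obj (Conn_End k A L \<alpha>)" "Y \<in> obj (Conn_End k A L \<alpha>)" "Z \<in> obj (Conn_End k A L \<alpha>)"
    "f \<in> hom_set (Conn_End k A L \<alpha>) X Y" "g \<in> hom_set (Conn_End k A L \<alpha>) Y Z"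
  obtain E \<psi> nab F \<psi>' nab' G \<psi>'' nab''
    where X: "X = (E, \<psi>, nab)" "Y = (F, \<psi>', nab')" "Z = (G, \<psi>'', nab'')"
    by (metis surj_pair)
  have E: "module A E" "psi_connection k A L \<alpha> E \<psi> nab" using * by (auto simp: X Conn_End_def)
  have f: "f \<in> lin_maps A E F"
    "\<And>x e. x \<in> carrier L \<Longrightarrow> e \<in> carrier E \<Longrightarrow> f (nab x e) = nab' x (f e)"
    "\<And>e. e \<in> carrier E \<Longrightarrow> f (\<psi> e) = \<psi>' (f e)"
    using * by (auto simp: X Conn_End_def)
  have g: "g \<in> lin_maps A F G"
    "\<And>x e. x \<in> carrier L \<Longrightarrow> e \<in> carrier F \<Longrightarrow> g (nab' x e) = nab'' x (g e)"
    "\<And>e. e \<in> carrier F \<Longrightarrow> g (\<psi>' e) = \<psi>'' (g e)"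
    using * by (auto simp: X Conn_End_def)
  have "f e \<in> carrier F" if "e \<in> carrier E" for e using f(1) that by (auto simp: lin_maps_def)
  then show "cat_comp (Conn_End k A L \<alpha>) X Y Z g f \<in> hom_set (Conn_End k A L \<alpha>) X Z"
    using compose_lin_maps[OF E(1) f(1) g(1)] psi_connection_closed[OF E(2)] f(2,3) g(2,3)
    by (simp add: X Conn_End_def compose_def)
qed (auto simp: Conn_End_def compose_id_on compose_assoc_lin)

section \<open>The object part of the functor and its inverse\<close>

definition Cf_inv ::
  "('k, 'a, 'q) module_scheme \<Rightarrow> ('a, 'l) lie_module \<Rightarrow>
   ('a, 'e) module \<times> ('a \<times> 'l \<Rightarrow> 'e \<Rightarrow> 'e) \<Rightarrow>
   ('a, 'e) module \<times> ('e \<Rightarrow> 'e) \<times> ('l \<Rightarrow> 'e \<Rightarrow> 'e)" where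
  "Cf_inv A L = (\<lambda>(E, \<rho>). (E, \<rho> (\<one>\<^bsub>A\<^esub>, \<zero>\<^bsub>L\<^esub>), \<lambda>x\<in>carrier L. \<rho> (\<zero>\<^bsub>A\<^esub>, x)))"

locale lr_module = lie_rinehart_algebra k A L \<alpha> + operators k A E
  for k :: "('k, 'z) ring_scheme" and A :: "('k, 'a) module"
    and L :: "('a, 'l) lie_module" and \<alpha> :: "'l \<Rightarrow> 'a \<Rightarrow> 'a"
    and E :: "('a, 'e) module"
begin

lemma psi_connectionD:
  assumes "psi_connection k A L \<alpha> E \<psi> nab"
  shows "\<And>e. e \<in> carrier E \<Longrightarrow> \<psi> e \<in> carrier E" "\<psi> \<in> extensional (carrier E)"
    "\<And>d e. d \<in> carrier E \<Longrightarrow> e \<in> carrier E \<Longrightarrow> \<psi> (d \<oplus>\<^bsub>E\<^esub> e) = \<psi> d \<oplus>\<^bsub>E\<^esub> \<psi> e"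
    "\<And>a e. a \<in> carrier A \<Longrightarrow> e \<in> carrier E \<Longrightarrow> \<psi> (a \<odot>\<^bsub>E\<^esub> e) = a \<odot>\<^bsub>E\<^esub> \<psi> e"
    "\<And>x. x \<in> carrier L \<Longrightarrow> nab x \<in> carrier (End_k k A E)" "nab \<in> extensional (carrier L)"
    "\<And>x y e. x \<in> carrier L \<Longrightarrow> y \<in> carrier L \<Longrightarrow> e \<in> carrier E
      \<Longrightarrow> nab (x \<oplus>\<^bsub>L\<^esub> y) e = nab x e \<oplus>\<^bsub>E\<^esub> nab y e"
    "\<And>a x e. a \<in> carrier A \<Longrightarrow> x \<in> carrier L \<Longrightarrow> e \<in> carrier E
      \<Longrightarrow> nab (a \<odot>\<^bsub>L\<^esub> x) e = a \<odot>\<^bsub>E\<^esub> nab x e"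
    "\<And>x a e. x \<in> carrier L \<Longrightarrow> a \<in> carrier A \<Longrightarrow> e \<in> carrier E
      \<Longrightarrow> nab x (a \<odot>\<^bsub>E\<^esub> e) = a \<odot>\<^bsub>E\<^esub> nab x e \<oplus>\<^bsub>E\<^esub> \<alpha> x a \<odot>\<^bsub>E\<^esub> \<psi> e"
  using assms
  by (auto simp: psi_connection_def End_A_def lin_maps_def End_k_add End_k_smult op_add_def Pi_iff)

text \<open>The map \<open>\<rho>\<close> is additive and respects both actions of \<open>A\<close>,
  so \<open>act_natural\<close> makes it compatible with all formal sums. That its values have order
  at most one is inherited from the extension: \<open>\<rho>\<close> sends the central elements
  \<open>ub - bu\<close> to central operators.\<close>

lemma Cf_obj_parts_connection:
  assumes "psi_connection k A L \<alpha> E \<psi> nab"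
  shows "parts_connection k A (lr_ext A L \<alpha> g) E (snd (Cf_obj A L (E, \<psi>, nab)))"
proof -
  note D = psi_connectionD[OF assms]
  define \<rho> where "\<rho> = snd (Cf_obj A L (E, \<psi>, nab))"
  have \<rho>: "\<rho> (a, x) = (\<lambda>e\<in>carrier E. a \<odot>\<^bsub>E\<^esub> \<psi> e \<oplus>\<^bsub>E\<^esub> nab x e)" if "a \<in> carrier A" "x \<in> carrier L" for a x
    using that by (simp add: \<rho>_def Cf_obj_def)
  have \<psi>_End: "\<psi> \<in> carrier (End_k k A E)"
    using D(1-4) by (intro End_kI) (auto simp: PiE_def struct_map_closed)
  have \<rho>_End: "\<rho> u \<in> carrier (End_k k A E)" if u': "u \<in> carrier X" for u
  proof -
    obtain a x where u: "u = (a, x)" "a \<in> carrier A" "x \<in> carrier L"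
      using u' by (auto simp: ext_group_simps)
    have "\<rho> u = op_add E (left_mult a \<psi>) (nab x)"
      using u by (auto simp: \<rho> op_add_def)
    then show ?thesis
      using op_add_closed[OF left_mult_closed[OF u(2) \<psi>_End] D(5)[OF u(3)]] by simp
  qed
  have add: "\<rho> (u \<oplus>\<^bsub>X\<^esub> v) = \<rho> u \<oplus>\<^bsub>End_k k A E\<^esub> \<rho> v" if "u \<in> carrier X" "v \<in> carrier X" for u v
    using that D(1,7) End_kD(2)[OF D(5)]
    by (auto simp: ext_group_simps \<rho> End_k_add op_add_def E.smult_l_distr E.M.a_ac intro!: restrict_ext)
  have left: "\<rho> (ext_left A L a u) = left_mult a (\<rho> u)" if "a \<in> carrier A" "u \<in> carrier X" for a u
    using that D(1,8) End_kD(2)[OF D(5)]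
    by (auto simp: ext_group_simps ext_left_apply \<rho> E.smult_r_distr E.smult_assoc1 intro!: restrict_ext)
  \<comment> \<open>This is where linearity of \<open>\<psi>\<close> and the Leibniz rule enter: the
    term \<open>\<alpha>(x)(b)\<psi>(e)\<close> comes from the \<open>z\<close> component of
    \<open>ub\<close> on one side and from \<open>nab x\<close> applied to \<open>be\<close> on the
    other.\<close>
  have right: "\<rho> (ext_right A L \<alpha> u b) = right_mult (\<rho> u) b" if "b \<in> carrier A" "u \<in> carrier X" for b u
    using that D(1,4,8,9) End_kD(2)[OF D(5)]
    by (auto simp: ext_group_simps ext_right_apply \<rho> E.smult_l_distr E.smult_assoc1 anchor_closed
        E.M.a_ac intro!: restrict_ext)
  have act: "\<rho> (Ext.act w u) = End.act w (\<rho> u)" if "w \<in> formal_sums A" "u \<in> carrier X" for w u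
    by (rule act_natural[OF Ext.bimodule_axioms End.bimodule_axioms _ add left right that])
      (auto simp: \<rho>_End)
  have \<rho>_Diff: "\<rho> u \<in> carrier (Diff1 k A E)" if u: "u \<in> carrier X" for u
  proof -
    have m: "\<rho> (v \<ominus>\<^bsub>X\<^esub> v') = \<rho> v \<ominus>\<^bsub>End_k k A E\<^esub> \<rho> v'" if "v \<in> carrier X" "v' \<in> carrier X" for v v'
      using add[of "v \<ominus>\<^bsub>X\<^esub> v'" v'] that
      by (simp add: Ext.M.minus_plus End.M.plus_minus \<rho>_End)
    have "End.central (right_mult (\<rho> u) b \<ominus>\<^bsub>End_k k A E\<^esub> left_mult b (\<rho> u))" if b: "b \<in> carrier A" for b
    proof -
      let ?v = "ext_right A L \<alpha> u b \<ominus>\<^bsub>X\<^esub> ext_left A L b u"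
      have c: "Ext.central ?v" using first_order_ext[OF u] b by (simp add: Ext.first_order_def)
      \<comment> \<open>Centrality of \<open>?v\<close> is an equation between its left and right
        multiples, and \<open>\<rho>\<close> carries both kinds of multiples over to
        operators.\<close>
      have "End.central (\<rho> ?v)"
        using c \<rho>_End[of ?v] left[of _ ?v] right[of _ ?v] unfolding Ext.central_def End.central_def
        by metis
      then show ?thesis
        using b u by (simp add: m left right Ext.l_closed Ext.r_closed)
    qed
    then show ?thesis
      using \<rho>_End[OF u] unfolding Diff1_iff End.first_order_def by blast
  qed
  have "\<rho> (p \<odot>\<^bsub>lr_ext A L \<alpha> g\<^esub> u) = p \<odot>\<^bsub>Diff1 k A E\<^esub> \<rho> u"
    if p: "p \<in> carrier (princ_parts k A)" and u: "u \<in> carrier X" for p u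
  proof -
    obtain w where w: "w \<in> formal_sums A" "p = pclass w"
      using p by (auto simp: carrier_princ_parts)
    show ?thesis
      using u by (simp only: w(2) lr_ext_smult[OF w(1)] Diff1_smult[OF w(1)] act[OF w(1)] \<rho>_Diff)
  qed
  moreover have "\<rho> \<in> extensional (carrier X)"
    by (simp add: \<rho>_def Cf_obj_def ext_group_simps)
  ultimately show ?thesis
    using \<rho>_Diff add unfolding \<rho>_def[symmetric] parts_connection_def lin_maps_def
    by (simp add: lr_ext_simps Diff1_add)
qed

text \<open>Linearity over the principal parts is tested on the class of a single tensor
  \<open>a \<otimes> b\<close>. Taking \<open>b\<close> or \<open>a\<close> to be the unit isolates
  the left or the right action.\<close>

lemma parts_connectionD:
  assumes "parts_connection k A (lr_ext A L \<alpha> g) E \<rho>"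
  shows "\<And>u. u \<in> carrier X \<Longrightarrow> \<rho> u \<in> carrier (End_k k A E)" "\<rho> \<in> extensional (carrier X)"
    "\<And>u v e. u \<in> carrier X \<Longrightarrow> v \<in> carrier X \<Longrightarrow> e \<in> carrier E
      \<Longrightarrow> \<rho> (u \<oplus>\<^bsub>X\<^esub> v) e = \<rho> u e \<oplus>\<^bsub>E\<^esub> \<rho> v e"
    "\<And>a u e. a \<in> carrier A \<Longrightarrow> u \<in> carrier X \<Longrightarrow> e \<in> carrier E
      \<Longrightarrow> \<rho> (ext_left A L a u) e = a \<odot>\<^bsub>E\<^esub> \<rho> u e"
    "\<And>b u e. b \<in> carrier A \<Longrightarrow> u \<in> carrier X \<Longrightarrow> e \<in> carrier E
      \<Longrightarrow> \<rho> (ext_right A L \<alpha> u b) e = \<rho> u (b \<odot>\<^bsub>E\<^esub> e)"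
proof -
  have \<rho>: "\<rho> \<in> lin_maps (princ_parts k A) (lr_ext A L \<alpha> g) (Diff1 k A E)" "\<rho> \<in> extensional (carrier X)"
    using assms by (auto simp: parts_connection_def lr_ext_simps)
  have \<rho>_Diff: "\<rho> u \<in> carrier (Diff1 k A E)" if "u \<in> carrier X" for u
    using \<rho> that by (auto simp: lin_maps_def lr_ext_simps)
  show End: "\<rho> u \<in> carrier (End_k k A E)" if "u \<in> carrier X" for u
    using \<rho>_Diff[OF that] by (simp add: Diff1_def)
  show "\<rho> \<in> extensional (carrier X)" by fact
  show "\<rho> (u \<oplus>\<^bsub>X\<^esub> v) e = \<rho> u e \<oplus>\<^bsub>E\<^esub> \<rho> v e"
    if "u \<in> carrier X" "v \<in> carrier X" "e \<in> carrier E" for u v e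
    using \<rho> that by (simp add: lin_maps_def lr_ext_simps Diff1_add End_k_add op_add_def)
  have pair: "\<rho> (ext_left A L a (ext_right A L \<alpha> u b)) e = a \<odot>\<^bsub>E\<^esub> \<rho> u (b \<odot>\<^bsub>E\<^esub> e)"
    if "a \<in> carrier A" "b \<in> carrier A" "u \<in> carrier X" "e \<in> carrier E" for a b u e
  proof -
    have w: "frag_of (a, b) \<in> formal_sums A" using that by simp
    have "\<rho> (pclass (frag_of (a, b)) \<odot>\<^bsub>lr_ext A L \<alpha> g\<^esub> u) = pclass (frag_of (a, b)) \<odot>\<^bsub>Diff1 k A E\<^esub> \<rho> u"
      using \<rho>(1) w that(3) by (simp add: lin_maps_def lr_ext_simps carrier_princ_parts)
    then have "\<rho> (ext_left A L a (ext_right A L \<alpha> u b)) = left_mult a (right_mult (\<rho> u) b)"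
      using that End \<rho>_Diff
      by (simp only: lr_ext_smult[OF w] Diff1_smult[OF w] Ext.act_of End.act_of)
    then show ?thesis using that by simp
  qed
  show "\<rho> (ext_left A L a u) e = a \<odot>\<^bsub>E\<^esub> \<rho> u e"
    if "a \<in> carrier A" "u \<in> carrier X" "e \<in> carrier E" for a u e
    using pair[of a "\<one>\<^bsub>A\<^esub>" u e] that by (simp add: Ext.r_one)
  show "\<rho> (ext_right A L \<alpha> u b) e = \<rho> u (b \<odot>\<^bsub>E\<^esub> e)"
    if "b \<in> carrier A" "u \<in> carrier X" "e \<in> carrier E" for b u e
    using pair[of "\<one>\<^bsub>A\<^esub>" b u e] that End_kD(2)[OF End[OF that(2)], of "b \<odot>\<^bsub>E\<^esub> e"]
    by (simp add: Ext.l_one Ext.r_closed)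
qed

text \<open>Compatibility with the right action at \<open>z\<close> gives linearity of
  \<open>\<rho>(z)\<close>, and at \<open>x\<close> in \<open>L\<close> it gives the Leibniz rule.
  The decomposition of \<open>(a, x)\<close> as \<open>a\<close> times \<open>z\<close> plus
  \<open>x\<close> then recovers \<open>\<rho>\<close> from the two pieces.\<close>

lemma Cf_inv_psi_connection:
  assumes "parts_connection k A (lr_ext A L \<alpha> g) E \<rho>"
  shows "psi_connection k A L \<alpha> E (\<rho> (\<one>\<^bsub>A\<^esub>, \<zero>\<^bsub>L\<^esub>)) (\<lambda>x\<in>carrier L. \<rho> (\<zero>\<^bsub>A\<^esub>, x))"
    and "Cf_obj A L (Cf_inv A L (E, \<rho>)) = (E, \<rho>)"
proof -
  note D = parts_connectionD[OF assms]
  define \<psi> where "\<psi> = \<rho> (\<one>\<^bsub>A\<^esub>, \<zero>\<^bsub>L\<^esub>)"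
  have z: "(\<one>\<^bsub>A\<^esub>, \<zero>\<^bsub>L\<^esub>) \<in> carrier X" and x: "\<And>x. x \<in> carrier L \<Longrightarrow> (\<zero>\<^bsub>A\<^esub>, x) \<in> carrier X"
    by (simp_all add: ext_group_simps)
  have az: "\<rho> (a, \<zero>\<^bsub>L\<^esub>) e = a \<odot>\<^bsub>E\<^esub> \<psi> e" if "a \<in> carrier A" "e \<in> carrier E" for a e
    using D(4)[OF that(1) z that(2)] that by (simp add: ext_left_apply \<psi>_def)
  have split: "\<rho> (a, x) e = a \<odot>\<^bsub>E\<^esub> \<psi> e \<oplus>\<^bsub>E\<^esub> \<rho> (\<zero>\<^bsub>A\<^esub>, x) e"
    if "a \<in> carrier A" "x \<in> carrier L" "e \<in> carrier E" for a x e
    using D(3)[of "(a, \<zero>\<^bsub>L\<^esub>)" "(\<zero>\<^bsub>A\<^esub>, x)" e] that by (simp add: ext_group_simps az)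
  have ax: "\<rho> (\<zero>\<^bsub>A\<^esub>, a \<odot>\<^bsub>L\<^esub> x) e = a \<odot>\<^bsub>E\<^esub> \<rho> (\<zero>\<^bsub>A\<^esub>, x) e"
    if "a \<in> carrier A" "x \<in> carrier L" "e \<in> carrier E" for a x e
    using D(4)[OF that(1) x[OF that(2)] that(3)] that by (simp add: ext_left_apply)
  have xx: "\<rho> (\<zero>\<^bsub>A\<^esub>, x \<oplus>\<^bsub>L\<^esub> y) e = \<rho> (\<zero>\<^bsub>A\<^esub>, x) e \<oplus>\<^bsub>E\<^esub> \<rho> (\<zero>\<^bsub>A\<^esub>, y) e"
    if "x \<in> carrier L" "y \<in> carrier L" "e \<in> carrier E" for x y e
    using D(3)[of "(\<zero>\<^bsub>A\<^esub>, x)" "(\<zero>\<^bsub>A\<^esub>, y)" e] that by (simp add: ext_group_simps)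
  have End: "\<rho> (\<zero>\<^bsub>A\<^esub>, x) \<in> carrier (End_k k A E)" if "x \<in> carrier L" for x
    using D(1)[OF x[OF that]] .
  \<comment> \<open>Because the anchor vanishes at zero, \<open>zb\<close> is the pair of
    \<open>b\<close> and zero. The right action evaluates \<open>\<rho>\<close> there as
    \<open>\<psi>\<close> after multiplication by \<open>b\<close>, and \<open>az\<close> evaluates
    it as \<open>b\<close> times \<open>\<psi>\<close>.\<close>
  have "\<psi> \<in> End_A A E"
    using End_kD[OF D(1)[OF z], folded \<psi>_def] D(5)[OF _ z, folded \<psi>_def] az
    by (auto simp: End_A_def lin_maps_def PiE_def ext_right_apply anchor_zero)
  moreover have "(\<lambda>x\<in>carrier L. \<rho> (\<zero>\<^bsub>A\<^esub>, x)) \<in> lin_maps A L (End_k k A E)"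
  proof -
    have "\<rho> (\<zero>\<^bsub>A\<^esub>, x \<oplus>\<^bsub>L\<^esub> y) = op_add E (\<rho> (\<zero>\<^bsub>A\<^esub>, x)) (\<rho> (\<zero>\<^bsub>A\<^esub>, y))"
      if "x \<in> carrier L" "y \<in> carrier L" for x y
      using that End by (intro End_k_ext) (auto simp: op_add_closed, simp add: op_add_def xx)
    moreover have "\<rho> (\<zero>\<^bsub>A\<^esub>, a \<odot>\<^bsub>L\<^esub> x) = left_mult a (\<rho> (\<zero>\<^bsub>A\<^esub>, x))"
      if "a \<in> carrier A" "x \<in> carrier L" for a x
      using that End by (intro End_k_ext) (auto simp: left_mult_closed ax)
    ultimately show ?thesis
      using End by (simp add: lin_maps_def End_k_add End_k_smult)
  qed
  \<comment> \<open>The element \<open>xa\<close> of the extension has first component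
    \<open>\<alpha> x a\<close> and second component \<open>ax\<close>; \<open>split\<close>
    separates these into the two summands.\<close>
  moreover have "\<rho> (\<zero>\<^bsub>A\<^esub>, x) (a \<odot>\<^bsub>E\<^esub> e) = a \<odot>\<^bsub>E\<^esub> \<rho> (\<zero>\<^bsub>A\<^esub>, x) e \<oplus>\<^bsub>E\<^esub> \<alpha> x a \<odot>\<^bsub>E\<^esub> \<psi> e"
    if "x \<in> carrier L" "a \<in> carrier A" "e \<in> carrier E" for x a e
    using D(5)[OF that(2) x[OF that(1)] that(3)] that End_kD(2)[OF End] End_kD(2)[OF D(1)[OF z], folded \<psi>_def]
    by (simp add: ext_right_apply anchor_closed split[of "\<alpha> x a" "a \<odot>\<^bsub>L\<^esub> x"] ax E.M.a_comm)
  ultimately show "psi_connection k A L \<alpha> E (\<rho> (\<one>\<^bsub>A\<^esub>, \<zero>\<^bsub>L\<^esub>)) (\<lambda>x\<in>carrier L. \<rho> (\<zero>\<^bsub>A\<^esub>, x))"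
    by (simp add: psi_connection_def \<psi>_def)
  have "(\<lambda>e\<in>carrier E. a \<odot>\<^bsub>E\<^esub> \<psi> e \<oplus>\<^bsub>E\<^esub> \<rho> (\<zero>\<^bsub>A\<^esub>, x) e) = \<rho> (a, x)"
    if "a \<in> carrier A" "x \<in> carrier L" for a x
    using End_kD(1)[OF D(1), of "(a, x)"] split[OF that] that
    by (intro extensionalityI[of _ "carrier E"]) (auto simp: PiE_def ext_group_simps)
  then have "snd (Cf_obj A L (Cf_inv A L (E, \<rho>))) u = \<rho> u" if "u \<in> carrier X" for u
    using that by (auto simp: Cf_obj_def Cf_inv_def ext_group_simps \<psi>_def)
  moreover have "snd (Cf_obj A L (Cf_inv A L (E, \<rho>))) \<in> extensional (carrier X)"
    by (simp add: Cf_obj_def Cf_inv_def ext_group_simps)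
  ultimately have "snd (Cf_obj A L (Cf_inv A L (E, \<rho>))) = \<rho>"
    using D(2) by (intro extensionalityI[of _ "carrier X"])
  then show "Cf_obj A L (Cf_inv A L (E, \<rho>)) = (E, \<rho>)"
    by (simp add: Cf_obj_def Cf_inv_def)
qed

text \<open>At \<open>z\<close> the formula for \<open>\<rho>\<close> leaves \<open>\<psi>\<close>
  plus the value of \<open>nab\<close> at zero, which vanishes by linearity; at
  \<open>(0, x)\<close> the coefficient of \<open>\<psi>\<close> is zero. Extensionality turns
  agreement on the carriers into equality.\<close>

lemma Cf_inv_Cf_obj:
  assumes "psi_connection k A L \<alpha> E \<psi> nab"
  shows "Cf_inv A L (Cf_obj A L (E, \<psi>, nab)) = (E, \<psi>, nab)"
proof -
  note D = psi_connectionD[OF assms]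
  have nab_zero: "nab \<zero>\<^bsub>L\<^esub> e = \<zero>\<^bsub>E\<^esub>" if "e \<in> carrier E" for e
    using D(8)[of "\<zero>\<^bsub>A\<^esub>" "\<zero>\<^bsub>L\<^esub>" e] End_kD(2)[OF D(5)] that by simp
  have "(\<lambda>e\<in>carrier E. \<one>\<^bsub>A\<^esub> \<odot>\<^bsub>E\<^esub> \<psi> e \<oplus>\<^bsub>E\<^esub> nab \<zero>\<^bsub>L\<^esub> e) = \<psi>"
    using D(1,2) nab_zero by (intro extensionalityI[of _ "carrier E"]) auto
  moreover have "(\<lambda>e\<in>carrier E. \<zero>\<^bsub>A\<^esub> \<odot>\<^bsub>E\<^esub> \<psi> e \<oplus>\<^bsub>E\<^esub> nab x e) = nab x" if "x \<in> carrier L" for x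
    using D(1) End_kD(1,2)[OF D(5)[OF that]]
    by (intro extensionalityI[of _ "carrier E"]) (auto simp: PiE_def)
  ultimately show ?thesis
    using D(6) by (auto simp: Cf_obj_def Cf_inv_def intro!: extensionalityI[of _ "carrier L"])
qed

text \<open>Terms in which no coefficient is differentiated, apart from the double derivative, are
  symmetric in the two arguments and drop out of the commutator. The remaining coefficient
  \<open>\<alpha>(x)(b) - \<alpha>(y)(a)\<close> also occurs in the bracket of the extension and
  cancels, leaving the curvature of \<open>nab\<close> and the value of \<open>g\<close> with a
  minus sign.\<close>

lemma curvature_Cf_obj:
  assumes nab: "lr_connection k A L \<alpha> E nab" and \<rho>: "(E, \<rho>) = Cf_obj A L (E, id_on E, nab)"
    and a: "a \<in> carrier A" and b: "b \<in> carrier A" and x: "x \<in> carrier L" and y: "y \<in> carrier L"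
    and e: "e \<in> carrier E" and g: "g x y \<in> carrier A"
  shows "curvature (lr_ext A L \<alpha> g) E \<rho> (a, x) (b, y) e
    = curvature L E nab x y e \<ominus>\<^bsub>E\<^esub> g x y \<odot>\<^bsub>E\<^esub> e"
proof -
  note D = psi_connectionD[OF nab[unfolded lr_connection_def]]
  have [simp]: "nab x e \<in> carrier E" if "x \<in> carrier L" "e \<in> carrier E" for x e
    using End_kD(2)[OF D(5)] that .
  have \<rho>_apply: "\<rho> (a, x) e = a \<odot>\<^bsub>E\<^esub> e \<oplus>\<^bsub>E\<^esub> nab x e"
    if "a \<in> carrier A" "x \<in> carrier L" "e \<in> carrier E" for a x e
    using \<rho> that by (simp add: Cf_obj_def id_on_def)
  \<comment> \<open>The grouping puts the part symmetric under exchange of \<open>(a, x)\<close> and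
    \<open>(b, y)\<close> first, ready for \<open>plus_minus_cancel\<close>.\<close>
  have two: "\<rho> (a, x) (\<rho> (b, y) e) = ((a \<otimes>\<^bsub>A\<^esub> b) \<odot>\<^bsub>E\<^esub> e \<oplus>\<^bsub>E\<^esub> (a \<odot>\<^bsub>E\<^esub> nab y e \<oplus>\<^bsub>E\<^esub> b \<odot>\<^bsub>E\<^esub> nab x e))
      \<oplus>\<^bsub>E\<^esub> (\<alpha> x b \<odot>\<^bsub>E\<^esub> e \<oplus>\<^bsub>E\<^esub> nab x (nab y e))"
    if "a \<in> carrier A" "b \<in> carrier A" "x \<in> carrier L" "y \<in> carrier L" for a b x y
    using that e
    by (simp add: \<rho>_apply End_kD(3)[OF D(5)] D(9) E.smult_r_distr E.smult_assoc1 id_on_def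
        anchor_closed E.M.a_ac)
  let ?P = "(a \<otimes>\<^bsub>A\<^esub> b) \<odot>\<^bsub>E\<^esub> e \<oplus>\<^bsub>E\<^esub> (a \<odot>\<^bsub>E\<^esub> nab y e \<oplus>\<^bsub>E\<^esub> b \<odot>\<^bsub>E\<^esub> nab x e)"
  let ?S = "\<alpha> x b \<odot>\<^bsub>E\<^esub> e" and ?S' = "\<alpha> y a \<odot>\<^bsub>E\<^esub> e"
  let ?T = "nab x (nab y e)" and ?T' = "nab y (nab x e)"
  let ?F = "g x y \<odot>\<^bsub>E\<^esub> e" and ?W = "nab (lbr L x y) e"
  let ?D = "?S \<ominus>\<^bsub>E\<^esub> ?S'" and ?K = "?T \<ominus>\<^bsub>E\<^esub> ?T'"
  have [simp]: "?P \<in> carrier E" "?S \<in> carrier E" "?S' \<in> carrier E" "?T \<in> carrier E" "?T' \<in> carrier E"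
    "?F \<in> carrier E" "?W \<in> carrier E"
    using a b x y e g by (simp_all add: anchor_closed lbr_closed)
  have "(b \<otimes>\<^bsub>A\<^esub> a) \<odot>\<^bsub>E\<^esub> e \<oplus>\<^bsub>E\<^esub> (b \<odot>\<^bsub>E\<^esub> nab x e \<oplus>\<^bsub>E\<^esub> a \<odot>\<^bsub>E\<^esub> nab y e) = ?P"
    using a b x y e by (simp add: A.m_comm E.M.a_comm)
  then have "\<rho> (a, x) (\<rho> (b, y) e) \<ominus>\<^bsub>E\<^esub> \<rho> (b, y) (\<rho> (a, x) e) = (?S \<oplus>\<^bsub>E\<^esub> ?T) \<ominus>\<^bsub>E\<^esub> (?S' \<oplus>\<^bsub>E\<^esub> ?T')"
    using two[OF a b x y] two[OF b a y x] by (simp add: E.M.plus_minus_cancel)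
  also have "\<dots> = ?D \<oplus>\<^bsub>E\<^esub> ?K"
    by (simp add: a_minus_def E.M.minus_add E.M.a_ac)
  finally have comm: "commutator E (\<rho> (a, x)) (\<rho> (b, y)) e = ?D \<oplus>\<^bsub>E\<^esub> ?K"
    using e by (simp add: commutator_def)
  \<comment> \<open>The bracket is written with the same leading term \<open>?D\<close> as the
    commutator, so that \<open>?D\<close> cancels in the curvature.\<close>
  have "\<rho> (lbr (lr_ext A L \<alpha> g) (a, x) (b, y)) e = ?D \<oplus>\<^bsub>E\<^esub> (?F \<oplus>\<^bsub>E\<^esub> ?W)"
    using a b x y e g
    by (simp add: lr_ext_simps \<rho>_apply anchor_closed lbr_closed E.smult_l_distr a_minus_def
        E.smult_l_minus E.M.a_assoc)
  then have "curvature (lr_ext A L \<alpha> g) E \<rho> (a, x) (b, y) e = ?K \<ominus>\<^bsub>E\<^esub> (?F \<oplus>\<^bsub>E\<^esub> ?W)"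
    using e by (simp add: curvature_def comm E.M.plus_minus_cancel)
  also have "\<dots> = (?K \<ominus>\<^bsub>E\<^esub> ?W) \<ominus>\<^bsub>E\<^esub> ?F"
    by (simp add: a_minus_def E.M.minus_add E.M.a_ac)
  also have "?K \<ominus>\<^bsub>E\<^esub> ?W = curvature L E nab x y e"
    using e by (simp add: curvature_def commutator_def)
  finally show ?thesis .
qed

end

section \<open>Morphisms, and the assembly of the three claims\<close>

context lie_rinehart_algebra
begin

lemma lr_moduleI: "module A E \<Longrightarrow> lr_module k A L \<alpha> E"
  by (simp add: lr_module_def operators_def lie_rinehart_algebra_axioms tensor_square_axioms)

text \<open>The pair of \<open>\<psi>\<close> and \<open>nab\<close> and the map
  \<open>\<rho>\<close> determine each other linearly over \<open>A\<close>, so an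
  \<open>A\<close>-linear map commutes with one exactly when it commutes with the other. Equality of
  the sets makes the functor fully faithful with \<open>Cf_mor\<close> as the identity.\<close>

lemma Cf_hom_iff:
  assumes "(E, \<psi>, nab) \<in> obj (Conn_End k A L \<alpha>)" "(F, \<psi>', nab') \<in> obj (Conn_End k A L \<alpha>)"
  shows "hom_set (Conn k A (lr_ext A L \<alpha> g)) (Cf_obj A L (E, \<psi>, nab)) (Cf_obj A L (F, \<psi>', nab'))
    = hom_set (Conn_End k A L \<alpha>) (E, \<psi>, nab) (F, \<psi>', nab')"
proof -
  have E: "module A E" "psi_connection k A L \<alpha> E \<psi> nab"
    and F: "module A F" "psi_connection k A L \<alpha> F \<psi>' nab'"
    using assms by (auto simp: Conn_End_def)
  interpret E: lr_module k A L \<alpha> E by (rule lr_moduleI[OF E(1)])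
  interpret F: lr_module k A L \<alpha> F by (rule lr_moduleI[OF F(1)])
  obtain \<rho> where \<rho>: "Cf_obj A L (E, \<psi>, nab) = (E, \<rho>)" by (simp add: Cf_obj_def)
  obtain \<rho>' where \<rho>': "Cf_obj A L (F, \<psi>', nab') = (F, \<rho>')" by (simp add: Cf_obj_def)
  have inv: "Cf_inv A L (E, \<rho>) = (E, \<psi>, nab)" "Cf_inv A L (F, \<rho>') = (F, \<psi>', nab')"
    using E.Cf_inv_Cf_obj[OF E(2)] F.Cf_inv_Cf_obj[OF F(2)] by (simp_all add: \<rho> \<rho>')
  have *: "(\<forall>u\<in>carrier X. \<forall>e\<in>carrier E. \<rho>' u (\<phi> e) = \<phi> (\<rho> u e)) \<longleftrightarrow>
      (\<forall>x\<in>carrier L. \<forall>e\<in>carrier E. \<phi> (nab x e) = nab' x (\<phi> e)) \<and> (\<forall>e\<in>carrier E. \<phi> (\<psi> e) = \<psi>' (\<phi> e))"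
    (is "?l \<longleftrightarrow> ?r") if \<phi>: "\<phi> \<in> lin_maps A E F" for \<phi>
  proof
    assume l: ?l
    \<comment> \<open>Reading the data off \<open>\<rho>\<close> and \<open>\<rho>'\<close> turns
      the given identity, taken at \<open>z\<close> and at the elements of \<open>L\<close>, into
      the two required ones.\<close>
    have "\<psi> = \<rho> (\<one>\<^bsub>A\<^esub>, \<zero>\<^bsub>L\<^esub>)" "\<psi>' = \<rho>' (\<one>\<^bsub>A\<^esub>, \<zero>\<^bsub>L\<^esub>)"
      "nab = (\<lambda>x\<in>carrier L. \<rho> (\<zero>\<^bsub>A\<^esub>, x))" "nab' = (\<lambda>x\<in>carrier L. \<rho>' (\<zero>\<^bsub>A\<^esub>, x))"
      using inv by (auto simp: Cf_inv_def)
    then show ?r using l by (simp add: ext_group_simps)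
  next
    assume r: ?r
    have \<phi>': "\<And>e. e \<in> carrier E \<Longrightarrow> \<phi> e \<in> carrier F"
      "\<And>d e. d \<in> carrier E \<Longrightarrow> e \<in> carrier E \<Longrightarrow> \<phi> (d \<oplus>\<^bsub>E\<^esub> e) = \<phi> d \<oplus>\<^bsub>F\<^esub> \<phi> e"
      "\<And>a e. a \<in> carrier A \<Longrightarrow> e \<in> carrier E \<Longrightarrow> \<phi> (a \<odot>\<^bsub>E\<^esub> e) = a \<odot>\<^bsub>F\<^esub> \<phi> e"
      using \<phi> by (auto simp: lin_maps_def)
    have "\<rho> = snd (Cf_obj A L (E, \<psi>, nab))" "\<rho>' = snd (Cf_obj A L (F, \<psi>', nab'))"
      by (simp_all add: \<rho> \<rho>')
    then show ?l
      using r psi_connection_closed[OF E(2)]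
      by (auto simp: Cf_obj_def ext_group_simps \<phi>')
  qed
  show ?thesis unfolding \<rho> \<rho>'
    by (simp add: Conn_def Conn_End_def lr_ext_simps(1)) (use * in blast)
qed

end

theorem theorem1p4:
  fixes k :: "('k, 'z) ring_scheme"
    and A :: "('k, 'a) module"
    and L :: "('a, 'l) lie_module"
    and \<alpha> :: "'l \<Rightarrow> 'a \<Rightarrow> 'a"
    and f :: "('a \<Rightarrow> 'a) \<Rightarrow> ('a \<Rightarrow> 'a) \<Rightarrow> 'a"
  assumes "lie_rinehart k A L \<alpha>"
    and "f \<in> lr_Z2 A (Der k A) (\<lambda>D. D)"
  shows "equivalence_of_categories
           (Conn_End k A L \<alpha> ::
             (('a, 'e) module \<times> ('e \<Rightarrow> 'e) \<times> ('l \<Rightarrow> 'e \<Rightarrow> 'e), 'e \<Rightarrow> 'e) precat)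
           (Conn k A (lr_ext A L \<alpha> (pullback2 \<alpha> f)))
           (Cf_obj A L) Cf_mor
       \<and> (\<forall>(E :: ('a, 'e) module) nab \<rho> a b x y e.
            module A E \<and> lr_connection k A L \<alpha> E nab \<and> (E, \<rho>) = Cf_obj A L (E, id_on E, nab) \<and>
            a \<in> carrier A \<and> b \<in> carrier A \<and> x \<in> carrier L \<and> y \<in> carrier L \<and> e \<in> carrier E \<longrightarrow>
            curvature (lr_ext A L \<alpha> (pullback2 \<alpha> f)) E \<rho> (a, x) (b, y) e
              = curvature L E nab x y e \<ominus>\<^bsub>E\<^esub> pullback2 \<alpha> f x y \<odot>\<^bsub>E\<^esub> e)
       \<and> (\<forall>(E :: ('a, 'e) module) \<rho>.
            (E, \<rho>) \<in> obj (Conn k A (lr_ext A L \<alpha> (pullback2 \<alpha> f))) \<longrightarrow>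
            (\<exists>\<psi> nab. (E, \<psi>, nab) \<in> obj (Conn_End k A L \<alpha>) \<and> Cf_obj A L (E, \<psi>, nab) = (E, \<rho>)))"
proof (intro conjI allI impI)
  interpret lie_rinehart_algebra k A L \<alpha> by (unfold_locales) (rule assms(1))
  let ?g = "pullback2 \<alpha> f"
  let ?C = "Conn_End k A L \<alpha> :: (('a, 'e) module \<times> ('e \<Rightarrow> 'e) \<times> ('l \<Rightarrow> 'e \<Rightarrow> 'e), 'e \<Rightarrow> 'e) precat"
  let ?D = "Conn k A (lr_ext A L \<alpha> ?g)
    :: (('a, 'e) module \<times> ('a \<times> 'l \<Rightarrow> 'e \<Rightarrow> 'e), 'e \<Rightarrow> 'e) precat"
  have C: "Cf_obj A L Y \<in> obj ?D \<and> Cf_inv A L (Cf_obj A L Y) = Y" if obj: "Y \<in> obj ?C" for Y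
  proof -
    obtain E \<psi> nab where Y: "Y = (E, \<psi>, nab)" "module A E" "psi_connection k A L \<alpha> E \<psi> nab"
      using obj by (auto simp: Conn_End_def)
    interpret lr_module k A L \<alpha> E by (rule lr_moduleI[OF Y(2)])
    show ?thesis
      using Cf_obj_parts_connection[OF Y(3), of ?g] Cf_inv_Cf_obj[OF Y(3)] Y(2)
      by (simp add: Y(1) Conn_def) (simp add: Cf_obj_def)
  qed
  have D: "Cf_inv A L Y \<in> obj ?C \<and> Cf_obj A L (Cf_inv A L Y) = Y" if obj: "Y \<in> obj ?D" for Y
  proof -
    obtain E \<rho> where Y: "Y = (E, \<rho>)" "module A E" "parts_connection k A (lr_ext A L \<alpha> ?g) E \<rho>"
      using obj by (auto simp: Conn_def)
    interpret lr_module k A L \<alpha> E by (rule lr_moduleI[OF Y(2)])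
    show ?thesis
      using Cf_inv_psi_connection[OF Y(3)] Y(2) by (simp add: Y(1) Conn_End_def) (simp add: Cf_inv_def)
  qed
  have hom: "hom_set ?D (Cf_obj A L Y) (Cf_obj A L Z) = hom_set ?C Y Z"
    if "Y \<in> obj ?C" "Z \<in> obj ?C" for Y Z
    using that by (cases Y rule: prod_cases3, cases Z rule: prod_cases3) (simp only: Cf_hom_iff)
  \<comment> \<open>Identities and composites involve only the underlying module of the first
    object, which \<open>Cf_obj\<close> retains. The other objects may therefore be arbitrary and
    unrelated on the two sides.\<close>
  have comp: "cat_id ?D (Cf_obj A L Y) = cat_id ?C Y"
    "cat_comp ?D (Cf_obj A L Y) Z' W' q p = cat_comp ?C Y Z W q p" for Y Z W Z' W' q p
    by (cases Y, simp add: Conn_def Conn_End_def Cf_obj_def)+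
  show "equivalence_of_categories ?C ?D (Cf_obj A L) Cf_mor"
  proof (rule equivalence_of_categoriesI[where Go = "Cf_inv A L" and Gm = "\<lambda>Y Z p. p"])
    show "cat_functor ?C ?D (Cf_obj A L) Cf_mor"
      by unfold_locales (use C hom in \<open>simp_all add: Cf_mor_def comp(1)\<close>, rule comp(2)[symmetric])
    show "cat_functor ?D ?C (Cf_inv A L) (\<lambda>Y Z p. p)"
    proof
      fix Y Z p assume Y: "Y \<in> obj ?D" "Z \<in> obj ?D" and "p \<in> hom_set ?D Y Z"
      then show "p \<in> hom_set ?C (Cf_inv A L Y) (Cf_inv A L Z)"
        using D[OF Y(1)] D[OF Y(2)] hom[of "Cf_inv A L Y" "Cf_inv A L Z"] by simp
    next
      fix Y assume "Y \<in> obj ?D"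
      then show "Cf_inv A L Y \<in> obj ?C" "cat_id ?D Y = cat_id ?C (Cf_inv A L Y)"
        using D[of Y] comp(1)[of "Cf_inv A L Y"] by simp_all
      fix Z W p q
      show "cat_comp ?D Y Z W q p = cat_comp ?C (Cf_inv A L Y) (Cf_inv A L Z) (Cf_inv A L W) q p"
        using D[OF \<open>Y \<in> obj ?D\<close>] comp(2)[of "Cf_inv A L Y"] by simp
    qed
  qed (use C D in \<open>simp_all add: category_Conn category_Conn_End Cf_mor_def\<close>)
next
  interpret lie_rinehart_algebra k A L \<alpha> by (unfold_locales) (rule assms(1))
  fix E :: "('a, 'e) module" and nab \<rho> a b x y e
  assume *: "module A E \<and> lr_connection k A L \<alpha> E nab \<and> (E, \<rho>) = Cf_obj A L (E, id_on E, nab) \<and>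
    a \<in> carrier A \<and> b \<in> carrier A \<and> x \<in> carrier L \<and> y \<in> carrier L \<and> e \<in> carrier E"
  then interpret lr_module k A L \<alpha> E by (intro lr_moduleI) simp
  \<comment> \<open>The anchor takes values in derivations, where the cochain \<open>f\<close> is
    defined with values in \<open>A\<close>.\<close>
  have "pullback2 \<alpha> f x y \<in> carrier A"
    using assms(2) anchor_Der[of x] anchor_Der[of y] *
    by (auto simp: pullback2_def lr_Z2_def lr_cochains2_def Pi_iff)
  then show "curvature (lr_ext A L \<alpha> (pullback2 \<alpha> f)) E \<rho> (a, x) (b, y) e
      = curvature L E nab x y e \<ominus>\<^bsub>E\<^esub> pullback2 \<alpha> f x y \<odot>\<^bsub>E\<^esub> e"
    using * by (intro curvature_Cf_obj) auto
next
  interpret lie_rinehart_algebra k A L \<alpha> by (unfold_locales) (rule assms(1))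
  fix E :: "('a, 'e) module" and \<rho>
  assume "(E, \<rho>) \<in> obj (Conn k A (lr_ext A L \<alpha> (pullback2 \<alpha> f)))"
  then have E: "module A E" "parts_connection k A (lr_ext A L \<alpha> (pullback2 \<alpha> f)) E \<rho>"
    by (auto simp: Conn_def)
  interpret lr_module k A L \<alpha> E by (rule lr_moduleI[OF E(1)])
  \<comment> \<open>The witnesses are the components of \<open>Cf_inv\<close>: the value of
    \<open>\<rho>\<close> at \<open>z\<close> and its restriction to \<open>L\<close>.\<close>
  show "\<exists>\<psi> nab. (E, \<psi>, nab) \<in> obj (Conn_End k A L \<alpha>) \<and> Cf_obj A L (E, \<psi>, nab) = (E, \<rho>)"
    using Cf_inv_psi_connection[OF E(2)] E(1) unfolding Conn_End_def Cf_inv_def by auto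
qed

end
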